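(* Let $H$, $A$, $A_1,\dots,A_m$, $\eta_1,\dots,\eta_m$, $M$, $f$, $\varphi_0,\varphi_1$, $T$, $n>1$, $\tau=T/n$, $t_k=k\tau$ and the scheme values $v_0,\dots,v_n$ be as described in the context. Suppose the Cauchy problem $$u''(t)+Au(t)+M(u(t))=f(t),\quad t\in[0,T],\qquad u(0)=\varphi_0,\quad u'(0)=\varphi_1$$ has a solution $u$. Put $z_k=v_k-u(t_k)$ and $\Delta z_0=z_1-z_0$. Then for every $k=1,\dots,n-1$, $$\|z_{k+1}\|\le \exp(c\,t_{k-1})\left(\gamma_0\left\|\frac{\Delta z_0}{\tau}\right\|+\gamma_1\|z_0\|+\Theta_k(\tau)\right),$$ where $c=\nu^{-1/2}a$, $\nu=\min_{1\le j\le m}\alpha_j$, $\gamma_0=\nu^{-1/2}+c\tau^2$, $\gamma_1=1+c\tau$, and $$\begin{aligned}\Theta_k(\tau)={}&\tau^2\sum_{i=1}^k\left[c_1\|Au(t_i)\|+c_3\|\widetilde f(t_i)\|\right]+\tau\sum_{i=1}^k\left[c_1J_i(t_{i-1},A^{1/2}u)+c_2J_i(t_{i+1},A^{1/2}u)\right]\\&+c_2\sum_{i=1}^k\int_{t_{i-1}}^{t_{i+1}}\left[J_i(t,A^{1/2}u)+J_i(t,A^{-1/2}\widetilde f)\right]dt,\end{aligned}$$ with $\widetilde f(t)=f(t)-M(u(t))$, $J_i(t,w)=\|w(t_i)-w(t)\|$ for an $H$-valued function $w$ on $[0,T]$, and $$c_1=\sum_{j=1}^m\eta_j^{-3/2}(\eta_j^{-1}a_j+1),\quad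 a_j=\|A_jA^{-1}\|<\infty,\quad c_0=\sum_{j=1}^m\eta_j^{-1/2}a_j,\quad c_2=m+c_0,\quad c_3=\eta_1^{-1/2}+m+c_0.$$
   Context: $H$ is a Hilbert space with norm $\|\cdot\|$ and inner product $(\cdot,\cdot)$. $A$ is a self-adjoint, positive definite (generally unbounded) operator with dense domain $D(A)\subset H$: $A=A^*$ and $(Au,u)\ge\alpha\|u\|^2$ for all $u\in D(A)$, with a constant $\alpha>0$. Moreover $A=\sum_{j=1}^mA_j$ as unbounded operators (so $D(A)=\bigcap_jD(A_j)$), where each $A_j=A_j^*\ge\alpha_jI$ with constant $\alpha_j>0$. The nonlinear operator $M:H\to H$ satisfies $\|M(u)-M(v)\|\le a\|u-v\|$ for all $u,v\in H$, with a constant $a>0$. $f:[0,T]\to H$ is a given continuous function, $T>0$, and $\varphi_0,\varphi_1\in H$ are given vectors. A solution of the Cauchy problem is a function $u:[0,T]\to H$ such that (a) $u$ is twice continuously differentiable on $[0,T]$; (b) $u(t)\in D(A)$ for all $t\in[0,T]$, and $Au(t)$ and $M(u(t))$ are continuous in $t$; (c) $u$ satisfies the equation on $[0,T]$ and the initial conditions. Scheme: fix weights $\eta_j$ with $0<\eta_j<1$, $\sum_{j=1}^m\eta_j=1$, an integer $n>1$, $\tau=T/n$, $t_k=k\tau$. Set $v_0=\varphi_0$, $v_1=\varphi_0+\tau\varphi_1$, and for $k=1,\dots,n-1$ set $v_{k+1}=\sum_{j=1}^m\eta_jy_{j,k+1}$, where $y_{j,k+1}$ ($j=1,\dots,m$)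 solves $$\eta_j\frac{y_{j,k+1}-2v_k+v_{k-1}}{\tau^2}+A_jy_{j,k+1}=\delta_{1,j}\left[f(t_k)-M(v_k)\right],$$ with $\delta_{1,j}$ the Kronecker symbol. *)

theory Defs
  imports "HOL-Analysis.Analysis"
begin

text \<open>
  An unbounded operator in \<open>H\<close> is identified with its graph \<open>G \<subseteq> H \<times> H\<close>.  Its domain is
  \<^const>\<open>Domain\<close>, its inverse is \<^const>\<open>converse\<close>, the operator product \<open>S\<^sup>2\<close> is \<open>S O S\<close>, and
  equality of sets is equality of operators, domains included.

  \<open>H\<close> is a real Hilbert space.  A complex one is covered by its real inner product \<open>Re (x, y)\<close>:
  for complex-linear operators this changes neither the adjoint nor positivity, nor the
  positive square root or the operator norm.
\<close>

type_synonym 'a unbounded_op = "('a \<times> 'a) set"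

definition op_apply :: "'a unbounded_op \<Rightarrow> 'a \<Rightarrow> 'a"  (infixr "\<cdot>" 75)
  where "G \<cdot> x = (THE y. (x, y) \<in> G)"

definition linear_op :: "'a::real_vector unbounded_op \<Rightarrow> bool"
  where "linear_op G \<longleftrightarrow> subspace G \<and> single_valued G"

definition adjoint_op :: "'a::real_inner unbounded_op \<Rightarrow> 'a unbounded_op"
  where "adjoint_op G = {(y, z). \<forall>(x, w) \<in> G. inner w y = inner x z}"

definition selfadjoint_op :: "'a::real_inner unbounded_op \<Rightarrow> bool"
  where "selfadjoint_op G \<longleftrightarrow>
    linear_op G \<and> closure (Domain G) = UNIV \<and> adjoint_op G = G"

definition op_ge :: "'a::real_inner unbounded_op \<Rightarrow> real \<Rightarrow> bool"
  where "op_ge G \<alpha> \<longleftrightarrow> (\<forall>x \<in> Domain G. inner (G \<cdot> x) x \<ge> \<alpha> * (norm x)\<^sup>2)"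

definition op_sum :: "'i set \<Rightarrow> ('i \<Rightarrow> 'a::real_vector unbounded_op) \<Rightarrow> 'a unbounded_op"
  where "op_sum I G = {(x, \<Sum>j\<in>I. G j \<cdot> x) | x. x \<in> (\<Inter>j\<in>I. Domain (G j))}"

text \<open>
  A nonnegative self-adjoint operator has exactly one nonnegative self-adjoint square root,
  so \<open>SOME\<close> involves no real choice.
\<close>
definition op_sqrt :: "'a::real_inner unbounded_op \<Rightarrow> 'a unbounded_op"
  where "op_sqrt G = (SOME S. selfadjoint_op S \<and> op_ge S 0 \<and> S O S = G)"

text \<open>Derivatives at the endpoints of \<open>[0, T]\<close> are one-sided.\<close>
definition cauchy_solution ::
  "'a::real_inner unbounded_op \<Rightarrow> ('a \<Rightarrow> 'a) \<Rightarrow> (real \<Rightarrow> 'a) \<Rightarrow> real \<Rightarrow> 'a \<Rightarrow> 'a \<Rightarrow> (real \<Rightarrow> 'a) \<Rightarrow> bool"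
  where "cauchy_solution A M f T \<phi>0 \<phi>1 u \<longleftrightarrow>
    (\<exists>u' u''.
      (\<forall>t\<in>{0..T}. (u has_vector_derivative u' t) (at t within {0..T})) \<and>
      (\<forall>t\<in>{0..T}. (u' has_vector_derivative u'' t) (at t within {0..T})) \<and>
      continuous_on {0..T} u'' \<and>
      (\<forall>t\<in>{0..T}. u t \<in> Domain A) \<and>
      continuous_on {0..T} (\<lambda>t. A \<cdot> u t) \<and>
      continuous_on {0..T} (\<lambda>t. M (u t)) \<and>
      (\<forall>t\<in>{0..T}. u'' t + A \<cdot> u t + M (u t) = f t) \<and>
      u 0 = \<phi>0 \<and> u' 0 = \<phi>1)"

definition splitting_scheme ::
  "nat \<Rightarrow> (nat \<Rightarrow> 'a::real_inner unbounded_op) \<Rightarrow> (nat \<Rightarrow> real) \<Rightarrow> ('a \<Rightarrow> 'a) \<Rightarrow> (real \<Rightarrow> 'a)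
    \<Rightarrow> real \<Rightarrow> nat \<Rightarrow> 'a \<Rightarrow> 'a \<Rightarrow> (nat \<Rightarrow> 'a) \<Rightarrow> bool"
  where "splitting_scheme m A \<eta> M f \<tau> n \<phi>0 \<phi>1 v \<longleftrightarrow>
    v 0 = \<phi>0 \<and> v 1 = \<phi>0 + \<tau> *\<^sub>R \<phi>1 \<and>
    (\<exists>y :: nat \<Rightarrow> nat \<Rightarrow> 'a. \<forall>k\<in>{1..n - 1}.
      v (k + 1) = (\<Sum>j=1..m. \<eta> j *\<^sub>R y j (k + 1)) \<and>
      (\<forall>j\<in>{1..m}.
        y j (k + 1) \<in> Domain (A j) \<and>
        \<eta> j *\<^sub>R ((y j (k + 1) - 2 *\<^sub>R v k + v (k - 1)) /\<^sub>R \<tau>\<^sup>2) + A j \<cdot> y j (k + 1)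
          = (if j = 1 then f (real k * \<tau>) - M (v k) else 0)))"

end

theory Submission
  imports Defs
begin

text \<open>
  With \<open>L\<^sub>j = (I + \<tau>\<^sup>2 \<eta>\<^sub>j\<^sup>-\<^sup>1 A\<^sub>j)\<^sup>-\<^sup>1\<close> and \<open>L = \<Sum> \<eta>\<^sub>j L\<^sub>j\<close> the scheme is the three-term recurrence
  \<open>v\<^sub>k\<^sub>+\<^sub>1 = L (2 v\<^sub>k - v\<^sub>k\<^sub>-\<^sub>1) + \<tau>\<^sup>2 L\<^sub>1 (f(t\<^sub>k) - M(v\<^sub>k))\<close>, solved by polynomials \<open>V\<^sub>k\<close> in the bounded operator
  \<open>0 \<le> L \<le> I\<close>. Their energy identity bounds \<open>V\<^sub>k (I - L)\<^sup>1\<^sup>/\<^sup>2\<close> by \<open>1\<close>. Since \<open>I - L\<close> dominates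
  \<open>\<eta>\<^sub>j (I - L\<^sub>j)\<close>, half a power of \<open>\<tau>\<^sup>2 A\<^sub>j\<close> is thereby absorbed. To use this for the second difference
  of the exact solution, that difference is cut by the resolvent \<open>R = (I + \<tau>\<^sup>2 A)\<^sup>-\<^sup>1\<close> of the full operator:
  \<open>V\<^sub>k \<tau> A\<^sup>1\<^sup>/\<^sup>2 R\<close> is bounded by \<open>c\<^sub>2\<close> even though \<open>V\<^sub>k \<tau> A\<^sup>1\<^sup>/\<^sup>2\<close> is not bounded and the \<open>A\<^sub>j\<close> do not commute.
  The discrete Gronwall inequality finishes the argument.
\<close>

section \<open>Self-adjoint operators and their square roots\<close>

text \<open>The error is measured with half a power of A: by the equation, A^(-1/2) u'' = A^(-1/2)
  \<open>ft\<close> - A^(1/2) u, and the increments of these two functions are what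
  \<open>\<Theta>\<close> integrates. Estimating the Taylor remainder in this weak norm costs a
  factor A^(1/2); the factor \<tau> that pays for it is the maximum of the Taylor kernel. Since L
  and R do not commute in general, there is no joint functional calculus, and the bounds are proved
  by duality and quadratic forms. Origin of the constants: \<nu>^(-1/2) expresses the gap (1 +
  \<tau>^2 \<nu>) L <= I, which bounds \<tau> V_k for k >= 2. In \<open>c2\<close>, the summand m
  counts one use of A_j <= A (as forms) per index, and \<open>c0\<close> is the price of replacing
  A_j A^(-1) by P_j A_j A^(-1). The terms c \<tau>^2 in \<open>\<gamma>0\<close> and c \<tau> in
  \<open>\<gamma>1\<close> come from z_1, the one value in the Gronwall sum that is expressed
  through z_0 and the initial increment. The argument produces m + \<open>c2\<close> and
  \<open>c2\<close> where the theorem has \<open>c1\<close>, which majorizes both.\<close>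

lemma closed_subspace_orthogonal:
  fixes V :: "'a::{real_inner, complete_space} set"
  assumes V: "subspace V" "closed V" and h: "h \<notin> V"
  obtains y where "y \<noteq> 0" "\<And>x. x \<in> V \<Longrightarrow> inner x y = 0"
proof -
  have ne: "V \<noteq> {}" using V(1) subspace_0 by blast
  define d where "d = infdist h V"
  have d0: "d > 0"
    using infdist_pos_not_in_closed[OF V(2) ne h] by (simp add: d_def)
  have dle: "d \<le> norm (h - x)" if "x \<in> V" for x
    using infdist_le[OF that, of h] by (simp add: d_def dist_norm)
  have "\<exists>x\<in>V. norm (h - x) < d + 1 / real (Suc n)" for n
  proof (rule ccontr)
    assume "\<not> ?thesis"
    then have "d + 1 / real (Suc n) \<le> (INF x\<in>V. dist h x)"
      by (intro cINF_greatest[OF ne]) (force simp: dist_norm not_less)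
    then show False using ne by (simp add: d_def infdist_def)
  qed
  then obtain x where x: "\<And>n. x n \<in> V" "\<And>n. norm (h - x n) < d + 1 / real (Suc n)"
    by metis
  have par: "(norm (x i - x j))\<^sup>2 \<le> 2 * (norm (h - x i))\<^sup>2 + 2 * (norm (h - x j))\<^sup>2 - 4 * d\<^sup>2" for i j
  proof -
    have "(1/2) *\<^sub>R (x i + x j) \<in> V" using x V(1) by (simp add: subspace_add subspace_scale)
    then have "d\<^sup>2 \<le> (norm (h - (1/2) *\<^sub>R (x i + x j)))\<^sup>2"
      using dle d0 by (intro power_mono) auto
    moreover have "(norm (x i - x j))\<^sup>2 = 2 * (norm (h - x i))\<^sup>2 + 2 * (norm (h - x j))\<^sup>2
        - 4 * (norm (h - (1/2) *\<^sub>R (x i + x j)))\<^sup>2"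
      by (simp add: power2_norm_eq_inner inner_diff_left inner_diff_right inner_add_left
          inner_add_right inner_commute algebra_simps)
    ultimately show ?thesis by simp
  qed
  have "Cauchy x"
  proof (rule metric_CauchyI)
    fix e :: real assume e: "e > 0"
    have "(\<lambda>n. 4 * (d + 1 / real (Suc n))\<^sup>2 - 4 * d\<^sup>2) \<longlonglongrightarrow> 4 * (d + 0)\<^sup>2 - 4 * d\<^sup>2"
      by (intro tendsto_intros LIMSEQ_Suc[OF lim_1_over_n])
    then have "\<forall>\<^sub>F n in sequentially. 4 * (d + 1 / real (Suc n))\<^sup>2 - 4 * d\<^sup>2 < e\<^sup>2"
      using e by (intro order_tendstoD(2)) auto
    then obtain N where N: "4 * (d + 1 / real (Suc N))\<^sup>2 - 4 * d\<^sup>2 < e\<^sup>2"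
      by (auto simp: eventually_sequentially)
    show "\<exists>M. \<forall>m\<ge>M. \<forall>n\<ge>M. dist (x m) (x n) < e"
    proof (intro exI[of _ N] allI impI)
      fix i j assume ij: "N \<le> i" "N \<le> j"
      have *: "(norm (h - x k))\<^sup>2 \<le> (d + 1 / real (Suc N))\<^sup>2" if "N \<le> k" for k
      proof (rule power_mono)
        have "1 / real (Suc k) \<le> 1 / real (Suc N)" using that by (simp add: field_simps)
        then show "norm (h - x k) \<le> d + 1 / real (Suc N)" using x(2)[of k] by linarith
      qed simp
      have "(norm (x i - x j))\<^sup>2 < e\<^sup>2"
        using par[of i j] *[OF ij(1)] *[OF ij(2)] N by linarith
      then show "dist (x i) (x j) < e"
        using e by (simp add: dist_norm power2_less_imp_less)
    qed
  qed
  then obtain p where p: "x \<longlonglongrightarrow> p" using Cauchy_convergent convergent_def by blast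
  have pV: "p \<in> V" using closed_sequentially[OF V(2)] x(1) p by blast
  have "(\<lambda>n. norm (h - x n)) \<longlonglongrightarrow> norm (h - p)" by (intro tendsto_intros p)
  moreover have "(\<lambda>n. d + 1 / real (Suc n)) \<longlonglongrightarrow> d + 0"
    by (intro tendsto_intros LIMSEQ_Suc[OF lim_1_over_n])
  ultimately have "norm (h - p) \<le> d"
    using x(2) by (intro LIMSEQ_le) (auto intro: less_imp_le)
  then have pd: "norm (h - p) = d" using dle[OF pV] by simp
  show thesis
  proof
    show "h - p \<noteq> 0" using pV h by auto
    fix y assume y: "y \<in> V"
    \<comment> \<open>The minimizer \<open>p\<close> is compared with its perturbations along
      \<open>y\<close>; the best perturbation, chosen below as \<open>r\<close>, improves the
      distance unless the inner product vanishes.\<close>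
    have key: "2 * s * inner y (h - p) \<le> s\<^sup>2 * (norm y)\<^sup>2" for s
    proof -
      have "p + s *\<^sub>R y \<in> V" using pV y V(1) by (simp add: subspace_add subspace_scale)
      then have "(norm (h - p))\<^sup>2 \<le> (norm (h - (p + s *\<^sub>R y)))\<^sup>2"
        using dle pd by (intro power_mono) auto
      also have "\<dots> = (norm (h - p))\<^sup>2 - 2 * s * inner y (h - p) + s\<^sup>2 * (norm y)\<^sup>2"
        unfolding power2_norm_eq_inner
        by (simp add: inner_diff_left inner_diff_right inner_add_left
          inner_add_right inner_commute algebra_simps power2_eq_square)
      finally show ?thesis by simp
    qed
    show "inner y (h - p) = 0"
    proof (cases "y = 0")
      case False
      define r where "r = inner y (h - p) / (norm y)\<^sup>2"
      have r: "r * (norm y)\<^sup>2 = inner y (h - p)" using False by (simp add: r_def)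
      have "2 * r * (r * (norm y)\<^sup>2) \<le> r\<^sup>2 * (norm y)\<^sup>2" using key[of r] r by simp
      then have "r\<^sup>2 * (norm y)\<^sup>2 \<le> 0" by (simp add: power2_eq_square)
      then have "r = 0" using False by (simp add: mult_le_0_iff)
      then show ?thesis using r by simp
    qed simp
  qed
qed

text \<open>A Baire argument: the norm is a supremum over a dense set of directions, so the sublevel
  sets \<open>K n\<close> of \<open>norm (T x)\<close> are closed; they exhaust the space, hence one
  contains a ball. Applied to A_j A^(-1), with \<open>D\<close> the domain of A_j, this is the
  finiteness of a_j.\<close>

lemma linear_bounded_if_weakly_bounded:
  fixes T :: "'a::{real_inner, complete_space} \<Rightarrow> 'b::real_inner"
  assumes T: "linear T" and D: "closure D = UNIV"
    and cont: "\<And>y. y \<in> D \<Longrightarrow> continuous_on UNIV (\<lambda>x. inner (T x) y)"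
  shows "bounded_linear T"
proof -
  have dense: "norm w \<le> n" if "0 \<le> n" "\<And>y. y \<in> D \<Longrightarrow> inner w y \<le> n * norm y" for w :: 'b and n
  proof (cases "w = 0")
    case False
    obtain y where y: "\<And>k. y k \<in> D" "y \<longlonglongrightarrow> w"
      using D closure_sequential[of w D] by auto
    have "inner w w \<le> n * norm w"
    proof (rule LIMSEQ_le)
      show "(\<lambda>k. inner w (y k)) \<longlonglongrightarrow> inner w w" by (intro tendsto_intros y)
      show "(\<lambda>k. n * norm (y k)) \<longlonglongrightarrow> n * norm w" by (intro tendsto_intros y)
    qed (use that y in blast)
    then have "norm w * norm w \<le> n * norm w"
      by (simp add: power2_norm_eq_inner[symmetric] power2_eq_square)
    then show ?thesis using False by simp
  qed (use that in simp)
  define K where "K n = {x. norm (T x) \<le> real n}" for n :: nat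
  have K_eq: "K n = (\<Inter>y\<in>D. {x. inner (T x) y \<le> real n * norm y})" for n
  proof (intro equalityI subsetI INT_I CollectI)
    fix x y assume "x \<in> K n"
    then show "inner (T x) y \<le> real n * norm y"
      unfolding K_def mem_Collect_eq
      by (meson mult_right_mono norm_cauchy_schwarz norm_ge_zero order_trans)
  next
    fix x assume "x \<in> (\<Inter>y\<in>D. {x. inner (T x) y \<le> real n * norm y})"
    then show "x \<in> K n" unfolding K_def by (auto intro!: dense)
  qed
  have closed: "closed (K n)" for n
    unfolding K_eq by (intro closed_INT ballI closed_Collect_le cont continuous_intros)
  have "\<exists>n. interior (K n) \<noteq> {}"
  proof (rule ccontr)
    assume "\<not> ?thesis"
    then have "Met_TC.mtopology interior_of \<Union>(range K) = {}"
      by (intro Met_TC.metric_Baire_category_alt) (auto simp: complete_UNIV closed)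
    moreover have "\<Union>(range K) = UNIV" unfolding K_def using real_nat_ceiling_ge by auto
    ultimately show False by simp
  qed
  then obtain n x e where e: "e > 0" "ball x e \<subseteq> K n"
    by (metis all_not_in_conv mem_interior)
  have "norm (T y) \<le> norm y * (4 * real n / e)" for y
  proof (cases "y = 0")
    case False
    \<comment> \<open>Half the radius, so that the translate by \<open>s *\<^sub>R y\<close> stays
      inside the open ball.\<close>
    define s where "s = e / (2 * norm y)"
    have s: "s > 0" using e False by (simp add: s_def)
    have "x + s *\<^sub>R y \<in> ball x e" "x \<in> ball x e"
      using e False s by (auto simp: dist_norm s_def)
    then have "x + s *\<^sub>R y \<in> K n" "x \<in> K n" using e(2) by blast+
    then have "norm (T (x + s *\<^sub>R y)) \<le> n" "norm (T x) \<le> n" unfolding K_def by auto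
    moreover have "T (x + s *\<^sub>R y) - T x = s *\<^sub>R T y"
      by (simp add: linear_add[OF T] linear_scale[OF T])
    ultimately have "norm (s *\<^sub>R T y) \<le> 2 * n"
      using norm_triangle_ineq4[of "T (x + s *\<^sub>R y)" "T x"] by simp
    then have "s * norm (T y) \<le> 2 * n" using s by simp
    then show ?thesis using e False by (simp add: s_def field_simps)
  qed (simp add: linear_0[OF T])
  then show ?thesis
    by (intro bounded_linear_intro[where K = "4 * real n / e"] linear_add[OF T] linear_scale[OF T])
qed

section \<open>Graphs of self-adjoint operators and their resolvents\<close>

lemma op_apply_eq: "single_valued G \<Longrightarrow> (x, y) \<in> G \<Longrightarrow> G \<cdot> x = y"
  by (auto simp: op_apply_def single_valued_def)

lemma op_apply_mem: "single_valued G \<Longrightarrow> x \<in> Domain G \<Longrightarrow> (x, G \<cdot> x) \<in> G"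
  by (auto simp: op_apply_eq)

lemma op_geD: "op_ge G \<beta> \<Longrightarrow> single_valued G \<Longrightarrow> (x, y) \<in> G \<Longrightarrow> \<beta> * (norm x)\<^sup>2 \<le> inner y x"
  by (force simp: op_ge_def op_apply_eq)

lemma selfadjoint_opD:
  assumes "selfadjoint_op G"
  shows "subspace G" "single_valued G" "closure (Domain G) = UNIV" "adjoint_op G = G"
  using assms by (auto simp: selfadjoint_op_def linear_op_def)

lemma selfadjoint_op_inner:
  "selfadjoint_op G \<Longrightarrow> (x, w) \<in> G \<Longrightarrow> (y, z) \<in> G \<Longrightarrow> inner w y = inner x z"
  unfolding selfadjoint_op_def adjoint_op_def by fast

lemma selfadjoint_opI:
  "selfadjoint_op G \<Longrightarrow> (\<And>x w. (x, w) \<in> G \<Longrightarrow> inner w y = inner x z) \<Longrightarrow> (y, z) \<in> G"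
  unfolding selfadjoint_op_def adjoint_op_def by fast

lemma closed_selfadjoint_op:
  assumes "selfadjoint_op G"
  shows "closed G"
proof -
  have "adjoint_op G = (\<Inter>p\<in>G. {q. inner (snd p) (fst q) = inner (fst p) (snd q)})"
    by (auto simp: adjoint_op_def) (metis fst_conv snd_conv)
  moreover have "closed \<dots>"
    by (intro closed_INT ballI closed_Collect_eq continuous_intros)
  ultimately show ?thesis using selfadjoint_opD(4)[OF assms] by simp
qed

text \<open>The range is closed because \<open>G\<close> is closed and the shifted operator is bounded below; a vector
  orthogonal to the range would lie in the kernel of the adjoint, that is, of the operator itself.\<close>

lemma selfadjoint_op_shift_surj:
  fixes G :: "'a::{real_inner, complete_space} unbounded_op"
  assumes G: "selfadjoint_op G" "op_ge G \<beta>" and pos: "\<kappa> > 0" "\<mu> + \<kappa> * \<beta> > 0"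
  shows "\<exists>x y. (x, y) \<in> G \<and> h = \<mu> *\<^sub>R x + \<kappa> *\<^sub>R y"
proof -
  note sv = selfadjoint_opD(2)[OF G(1)]
  let ?F = "\<lambda>p. \<mu> *\<^sub>R fst p + \<kappa> *\<^sub>R snd p :: 'a"
  define W where "W = ?F ` G"
  have linF: "linear ?F"
    by (auto intro!: linearI simp: algebra_simps)
  have subW: "subspace W" unfolding W_def using linF selfadjoint_opD(1)[OF G(1)] by (rule linear_subspace_image)
  have below: "(\<mu> + \<kappa> * \<beta>) * norm x \<le> norm (\<mu> *\<^sub>R x + \<kappa> *\<^sub>R y)" if "(x, y) \<in> G" for x y
  proof (cases "x = 0")
    case False
    have "(\<mu> + \<kappa> * \<beta>) * (norm x)\<^sup>2 \<le> inner (\<mu> *\<^sub>R x + \<kappa> *\<^sub>R y) x"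
      using mult_left_mono[OF op_geD[OF G(2) sv that], of \<kappa>] pos
      by (simp add: inner_add_left power2_norm_eq_inner algebra_simps)
    also have "\<dots> \<le> norm (\<mu> *\<^sub>R x + \<kappa> *\<^sub>R y) * norm x" by (rule norm_cauchy_schwarz)
    finally show ?thesis using False by (simp add: power2_eq_square mult.assoc[symmetric])
  qed simp
  have "closed W"
    unfolding closed_sequential_limits
  proof (intro allI impI, elim conjE)
    fix w l assume w: "\<forall>n. w n \<in> W" "w \<longlonglongrightarrow> l"
    then have "\<forall>n. \<exists>p. p \<in> G \<and> w n = ?F p" unfolding W_def by blast
    then obtain p where p: "\<And>n. p n \<in> G" "\<And>n. w n = ?F (p n)" by metis
    have "Cauchy (\<lambda>n. fst (p n))"
    proof (rule metric_CauchyI)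
      fix e :: real assume e: "e > 0"
      obtain N where N: "\<And>i j. i \<ge> N \<Longrightarrow> j \<ge> N \<Longrightarrow> dist (w i) (w j) < (\<mu> + \<kappa> * \<beta>) * e"
        using metric_CauchyD[OF LIMSEQ_imp_Cauchy[OF w(2)], of "(\<mu> + \<kappa> * \<beta>) * e"] e pos by auto
      show "\<exists>M. \<forall>i\<ge>M. \<forall>j\<ge>M. dist (fst (p i)) (fst (p j)) < e"
      proof (intro exI[of _ N] allI impI)
        fix i j assume ij: "N \<le> i" "N \<le> j"
        have "p i - p j \<in> G" using p selfadjoint_opD(1)[OF G(1)] by (simp add: subspace_diff)
        then have "(fst (p i) - fst (p j), snd (p i) - snd (p j)) \<in> G" by (simp add: minus_prod_def)
        from below[OF this] have "(\<mu> + \<kappa> * \<beta>) * norm (fst (p i) - fst (p j)) \<le> norm (w i - w j)"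
          by (simp add: p(2) algebra_simps)
        also have "\<dots> < (\<mu> + \<kappa> * \<beta>) * e" using N[OF ij] by (simp add: dist_norm)
        finally show "dist (fst (p i)) (fst (p j)) < e" using pos by (simp add: dist_norm)
      qed
    qed
    then obtain x where x: "(\<lambda>n. fst (p n)) \<longlonglongrightarrow> x" using Cauchy_convergent convergent_def by blast
    have "(\<lambda>n. (1 / \<kappa>) *\<^sub>R (w n - \<mu> *\<^sub>R fst (p n))) \<longlonglongrightarrow> (1 / \<kappa>) *\<^sub>R (l - \<mu> *\<^sub>R x)"
      by (intro tendsto_intros w x)
    moreover have "(1 / \<kappa>) *\<^sub>R (w n - \<mu> *\<^sub>R fst (p n)) = snd (p n)" for n
      using pos by (simp add: p(2))
    ultimately have "(\<lambda>n. snd (p n)) \<longlonglongrightarrow> (1 / \<kappa>) *\<^sub>R (l - \<mu> *\<^sub>R x)" by simp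
    with x have "(\<lambda>n. (fst (p n), snd (p n))) \<longlonglongrightarrow> (x, (1 / \<kappa>) *\<^sub>R (l - \<mu> *\<^sub>R x))" by (rule tendsto_Pair)
    then have "(x, (1 / \<kappa>) *\<^sub>R (l - \<mu> *\<^sub>R x)) \<in> G"
      using closed_sequentially[OF closed_selfadjoint_op[OF G(1)], of p] p(1) by simp
    moreover have "l = ?F (x, (1 / \<kappa>) *\<^sub>R (l - \<mu> *\<^sub>R x))" using pos by simp
    ultimately show "l \<in> W" unfolding W_def by (rule rev_image_eqI)
  qed
  have "h \<in> W"
  proof (rule ccontr)
    assume "h \<notin> W"
    then obtain y where y: "y \<noteq> 0" "\<And>x. x \<in> W \<Longrightarrow> inner x y = 0"
      using closed_subspace_orthogonal[OF subW \<open>closed W\<close>] by blast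
    have "(y, (- \<mu> / \<kappa>) *\<^sub>R y) \<in> G"
    proof (rule selfadjoint_opI[OF G(1)])
      fix x w assume "(x, w) \<in> G"
      then have "?F (x, w) \<in> W" unfolding W_def by (rule imageI)
      then have "\<mu> * inner x y + \<kappa> * inner w y = 0" using y(2) by (fastforce simp: inner_add_left)
      then show "inner w y = inner x ((- \<mu> / \<kappa>) *\<^sub>R y)" using pos by (simp add: field_simps)
    qed
    from below[OF this] have "(\<mu> + \<kappa> * \<beta>) * norm y \<le> 0" using pos by simp
    then show False using pos y(1) by (simp add: mult_le_0_iff)
  qed
  then show ?thesis unfolding W_def by force
qed

text \<open>Two parameters cover both uses: \<mu> = 0, \<kappa> = 1 gives the inverse, \<mu> = 1 the
  resolvent of \<kappa> G. Coercivity of the shifted operator makes the solution unique, and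
  linearity follows from uniqueness.\<close>

lemma selfadjoint_op_resolvent:
  fixes G :: "'a::{real_inner, complete_space} unbounded_op"
  assumes G: "selfadjoint_op G" "op_ge G \<beta>" and pos: "\<kappa> > 0" "\<mu> + \<kappa> * \<beta> > 0"
  obtains R where "linear R" "\<And>h. (R h, (h - \<mu> *\<^sub>R R h) /\<^sub>R \<kappa>) \<in> G"
    "\<And>x y. (x, y) \<in> G \<Longrightarrow> R (\<mu> *\<^sub>R x + \<kappa> *\<^sub>R y) = x"
proof -
  note sv = selfadjoint_opD(2)[OF G(1)] and sub = selfadjoint_opD(1)[OF G(1)]
  have "\<forall>h. \<exists>x y. (x, y) \<in> G \<and> \<mu> *\<^sub>R x + \<kappa> *\<^sub>R y = h"
    using selfadjoint_op_shift_surj[OF assms] by metis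
  then obtain R S where R: "\<And>h. (R h, S h) \<in> G" "\<And>h. \<mu> *\<^sub>R R h + \<kappa> *\<^sub>R S h = h"
    by metis
  have S: "(h - \<mu> *\<^sub>R R h) /\<^sub>R \<kappa> = S h" for h
  proof -
    have "h - \<mu> *\<^sub>R R h = \<kappa> *\<^sub>R S h" using R(2)[of h] by (simp add: algebra_simps)
    then show ?thesis using pos(1) by simp
  qed
  have uniq: "R (\<mu> *\<^sub>R x + \<kappa> *\<^sub>R y) = x" if "(x, y) \<in> G" for x y
  proof -
    let ?h = "\<mu> *\<^sub>R x + \<kappa> *\<^sub>R y"
    let ?d = "R ?h - x" and ?e = "S ?h - y"
    have "(R ?h, S ?h) - (x, y) \<in> G" using R(1) that sub by (intro subspace_diff)
    then have "(?d, ?e) \<in> G" by simp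
    then have "\<beta> * (norm ?d)\<^sup>2 \<le> inner ?e ?d" by (rule op_geD[OF G(2) sv])
    moreover have "\<mu> *\<^sub>R ?d + \<kappa> *\<^sub>R ?e = 0" using R(2)[of ?h] by (simp add: algebra_simps)
    then have "inner (\<mu> *\<^sub>R ?d + \<kappa> *\<^sub>R ?e) ?d = 0" by simp
    then have "\<mu> * (norm ?d)\<^sup>2 + \<kappa> * inner ?e ?d = 0"
      by (simp only: inner_add_left inner_scaleR_left power2_norm_eq_inner)
    ultimately have "(\<mu> + \<kappa> * \<beta>) * (norm ?d)\<^sup>2 \<le> 0"
      using mult_left_mono[of "\<beta> * (norm ?d)\<^sup>2" "inner ?e ?d" \<kappa>] pos
      by (simp add: algebra_simps)
    then show ?thesis using pos by (simp add: mult_le_0_iff)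
  qed
  have "linear R"
  proof (rule linearI)
    fix x y
    have "(R x, S x) + (R y, S y) \<in> G" using R(1) sub by (intro subspace_add)
    then have "R (\<mu> *\<^sub>R (R x + R y) + \<kappa> *\<^sub>R (S x + S y)) = R x + R y" by (intro uniq) simp
    moreover have "\<mu> *\<^sub>R (R x + R y) + \<kappa> *\<^sub>R (S x + S y)
        = (\<mu> *\<^sub>R R x + \<kappa> *\<^sub>R S x) + (\<mu> *\<^sub>R R y + \<kappa> *\<^sub>R S y)" by (simp add: algebra_simps)
    ultimately show "R (x + y) = R x + R y" by (simp add: R(2))
  next
    fix r x
    have "r *\<^sub>R (R x, S x) \<in> G" using R(1) sub by (intro subspace_scale)
    then have "R (\<mu> *\<^sub>R (r *\<^sub>R R x) + \<kappa> *\<^sub>R (r *\<^sub>R S x)) = r *\<^sub>R R x" by (intro uniq) simp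
    moreover have "\<mu> *\<^sub>R (r *\<^sub>R R x) + \<kappa> *\<^sub>R (r *\<^sub>R S x) = r *\<^sub>R (\<mu> *\<^sub>R R x + \<kappa> *\<^sub>R S x)"
      by (simp add: algebra_simps)
    ultimately show "R (r *\<^sub>R x) = r *\<^sub>R R x" by (simp add: R(2))
  qed
  then show thesis using that R(1) uniq by (simp add: S)
qed

text \<open>The iteration \<open>Y \<mapsto> (X + Y\<^sup>2) / 2\<close> converges because its increments are dominated by those of
  the scalar iteration \<open>r \<mapsto> (1 + r\<^sup>2) / 2\<close>, which increases and is bounded by \<open>1\<close>.\<close>

lemma sqrt_of_contraction_complement:
  fixes X :: "'a::{real_inner, complete_space} \<Rightarrow> 'a"
  assumes X: "linear X" "\<And>x. norm (X x) \<le> norm x" "\<And>x y. inner (X x) y = inner x (X y)"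
  obtains C where "linear C" "\<And>x. C (C x) = x - X x" "\<And>x y. inner (C x) y = inner x (C y)"
    "\<And>x. 0 \<le> inner (C x) x"
proof -
  define Y where "Y = rec_nat (\<lambda>_. 0) (\<lambda>_ Z x. (1/2) *\<^sub>R (X x + Z (Z x :: 'a)))"
  define r where "r = rec_nat (0::real) (\<lambda>_ s. (1/2) * (1 + s\<^sup>2))"
  have Y0: "Y 0 x = 0" and YS: "Y (Suc n) x = (1/2) *\<^sub>R (X x + Y n (Y n x))" for n x
    by (simp_all add: Y_def)
  have r0: "r 0 = 0" and rS: "r (Suc n) = (1/2) * (1 + (r n)\<^sup>2)" for n
    by (simp_all add: r_def)
  have r_bd: "0 \<le> r n \<and> r n \<le> 1" for n
  proof (induction n)
    case (Suc n)
    then have "(r n)\<^sup>2 \<le> 1" by (simp add: power_le_one)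
    then show ?case by (simp add: rS)
  qed (simp add: r0)
  have lin: "linear (Y n)" for n
  proof (induction n)
    case 0
    show ?case using Y0 by (intro linearI) auto
  next
    case (Suc n)
    show ?case
      by (intro linearI) (simp_all add: YS linear_add[OF Suc] linear_add[OF X(1)] linear_scale[OF Suc]
         linear_scale[OF X(1)] algebra_simps)
  qed
  have Yr: "norm (Y n x) \<le> r n * norm x" for n x
  proof (induction n arbitrary: x)
    case (Suc n)
    have "norm (Y n (Y n x)) \<le> r n * (r n * norm x)"
      by (rule order_trans[OF Suc mult_left_mono[OF Suc]]) (use r_bd in auto)
    then have "norm (X x + Y n (Y n x)) \<le> norm x + r n * (r n * norm x)"
      using X(2)[of x] by (intro norm_triangle_mono)
    then show ?case by (simp add: YS rS power2_eq_square algebra_simps flip: scaleR_right_distrib)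
  qed (simp add: Y0 r0)
  have dY: "norm (Y (Suc n) x - Y n x) \<le> (r (Suc n) - r n) * norm x" for n x
  proof (induction n arbitrary: x)
    case 0
    then show ?case using X(2)[of x] by (simp add: YS Y0 r0 rS)
  next
    case (Suc n)
    let ?a = "Y (Suc n)" and ?b = "Y n"
    have "Y (Suc (Suc n)) x - Y (Suc n) x = (1/2) *\<^sub>R (?a (?a x) - ?b (?b x))"
      by (simp add: YS[of "Suc n"] YS[of n x] algebra_simps)
    also have "?a (?a x) - ?b (?b x) = ?a (?a x - ?b x) + (?a (?b x) - ?b (?b x))"
      by (simp add: linear_diff[OF lin])
    finally have eq: "Y (Suc (Suc n)) x - Y (Suc n) x = (1/2) *\<^sub>R (?a (?a x - ?b x) + (?a (?b x) - ?b (?b x)))" .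
    have nn: "0 \<le> r (Suc n) - r n" if "norm x > 0"
      using order_trans[OF norm_ge_zero Suc[of x]] that by (simp add: zero_le_mult_iff)
    have "norm (?a (?a x - ?b x)) \<le> r (Suc n) * ((r (Suc n) - r n) * norm x)"
      by (rule order_trans[OF Yr mult_left_mono[OF Suc]]) (use r_bd in auto)
    moreover have "norm (?a (?b x) - ?b (?b x)) \<le> (r (Suc n) - r n) * (r n * norm x)"
    proof (cases "x = 0")
      case False
      then show ?thesis by (intro order_trans[OF Suc mult_left_mono[OF Yr]] nn) auto
    qed (simp add: linear_0[OF lin])
    ultimately have "norm (?a (?a x - ?b x) + (?a (?b x) - ?b (?b x)))
        \<le> r (Suc n) * ((r (Suc n) - r n) * norm x) + (r (Suc n) - r n) * (r n * norm x)"
      by (rule norm_triangle_mono)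
    also have "\<dots> = ((r (Suc n))\<^sup>2 - (r n)\<^sup>2) * norm x"
      by (simp add: power2_eq_square algebra_simps)
    also have "(r (Suc n))\<^sup>2 - (r n)\<^sup>2 = 2 * (r (Suc (Suc n)) - r (Suc n))"
    proof -
      have "2 * r (Suc (Suc n)) = 1 + (r (Suc n))\<^sup>2" by (simp add: rS[of "Suc n"])
      moreover have "2 * r (Suc n) = 1 + (r n)\<^sup>2" by (simp add: rS[of n])
      ultimately show ?thesis by (simp add: right_diff_distrib)
    qed
    finally show ?case unfolding eq norm_scaleR by (simp add: left_diff_distrib)
  qed
  have dY': "norm (Y (n + k) x - Y n x) \<le> (r (n + k) - r n) * norm x" for n k x
  proof (induction k)
    case (Suc k)
    have "norm ((Y (Suc (n + k)) x - Y (n + k) x) + (Y (n + k) x - Y n x))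
        \<le> (r (Suc (n + k)) - r (n + k)) * norm x + (r (n + k) - r n) * norm x"
      by (rule norm_triangle_mono[OF dY Suc])
    then show ?case by (simp add: algebra_simps)
  qed simp
  have "r n \<le> r (Suc n)" for n
    using sum_squares_ge_zero[of "1 - r n" 0] by (simp add: rS power2_eq_square algebra_simps)
  then have "incseq r" by (rule incseq_SucI)
  then obtain \<rho> where "r \<longlonglongrightarrow> \<rho>" using r_bd incseq_convergent[of r 1] by blast
  then have r_Cauchy: "Cauchy r" by (rule LIMSEQ_imp_Cauchy)
  have "Cauchy (\<lambda>n. Y n x)" for x
  proof (rule metric_CauchyI)
    fix e :: real assume e: "e > 0"
    then have "e / (norm x + 1) > 0" by (simp add: add_nonneg_pos)
    then obtain N where N: "\<And>i j. i \<ge> N \<Longrightarrow> j \<ge> N \<Longrightarrow> dist (r i) (r j) < e / (norm x + 1)"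
      using metric_CauchyD[OF r_Cauchy] by meson
    have *: "dist (Y i x) (Y j x) < e" if "N \<le> j" "j \<le> i" for i j
    proof -
      have "dist (Y i x) (Y j x) \<le> (r i - r j) * norm x"
        using dY'[of j "i - j" x] that by (simp add: dist_norm)
      also have "\<dots> \<le> (r i - r j) * (norm x + 1)"
        using incseqD[OF \<open>incseq r\<close> that(2)] by (intro mult_left_mono) auto
      also have "\<dots> < e" using N[of i j] that
        by (simp add: dist_real_def pos_less_divide_eq add_nonneg_pos abs_less_iff)
      finally show ?thesis .
    qed
    show "\<exists>M. \<forall>i\<ge>M. \<forall>j\<ge>M. dist (Y i x) (Y j x) < e"
      using * by (metis dist_commute nle_le)
  qed
  then have "\<forall>x. \<exists>l. (\<lambda>n. Y n x) \<longlonglongrightarrow> l" using Cauchy_convergent convergent_def by blast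
  then obtain Z where Z: "\<And>x. (\<lambda>n. Y n x) \<longlonglongrightarrow> Z x" by metis
  have Z_norm: "norm (Z x) \<le> norm x" for x
  proof (rule LIMSEQ_le_const2[OF tendsto_norm[OF Z]])
    show "\<exists>N. \<forall>n\<ge>N. norm (Y n x) \<le> norm x"
      using Yr r_bd by (meson mult_left_le_one_le norm_ge_zero order_trans)
  qed
  have Z_lin: "linear Z"
  proof (rule linearI)
    fix x y
    show "Z (x + y) = Z x + Z y"
      using LIMSEQ_unique[OF Z[of "x + y"]] tendsto_add[OF Z[of x] Z[of y]] by (simp add: linear_add[OF lin])
  next
    fix s x
    show "Z (s *\<^sub>R x) = s *\<^sub>R Z x"
      using LIMSEQ_unique[OF Z[of "s *\<^sub>R x"]] tendsto_scaleR[OF tendsto_const Z[of x], of s]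
      by (simp add: linear_scale[OF lin])
  qed
  have Y_sym: "inner (Y n x) y = inner x (Y n y)" for n x y
    by (induction n arbitrary: x y) (simp_all add: Y0 YS inner_add_left inner_add_right X(3))
  have Z_sym: "inner (Z x) y = inner x (Z y)" for x y
    using LIMSEQ_unique[OF tendsto_inner[OF Z[of x] tendsto_const[of y]]]
      tendsto_inner[OF tendsto_const[of x] Z[of y]] by (simp add: Y_sym)
  have ZZ: "2 *\<^sub>R Z x = X x + Z (Z x)" for x
  proof -
    \<comment> \<open>The square \<open>Y n (Y n x)\<close> is split at \<open>Z x\<close>; the
      uniform bound of \<open>Y n\<close> by 1 removes the part with the moving argument.\<close>
    have "(\<lambda>n. Y n (Y n x - Z x)) \<longlonglongrightarrow> 0"
    proof (rule Lim_null_comparison)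
      show "\<forall>\<^sub>F n in sequentially. norm (Y n (Y n x - Z x)) \<le> norm (Y n x - Z x)"
        using Yr r_bd by (intro always_eventually allI) (meson mult_left_le_one_le norm_ge_zero order_trans)
      show "(\<lambda>n. norm (Y n x - Z x)) \<longlonglongrightarrow> 0"
        using Z[of x] by (simp add: LIM_zero_iff tendsto_norm_zero)
    qed
    from tendsto_add[OF this Z[of "Z x"]] have "(\<lambda>n. Y n (Y n x)) \<longlonglongrightarrow> Z (Z x)"
      by (simp add: linear_diff[OF lin])
    then have "(\<lambda>n. Y (Suc n) x) \<longlonglongrightarrow> (1/2) *\<^sub>R (X x + Z (Z x))"
      unfolding YS by (intro tendsto_intros)
    from LIMSEQ_unique[OF this LIMSEQ_Suc[OF Z]] have eq: "(1/2) *\<^sub>R (X x + Z (Z x)) = Z x" .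
    have "2 *\<^sub>R Z x = 2 *\<^sub>R ((1/2) *\<^sub>R (X x + Z (Z x)))" by (simp only: eq)
    then show ?thesis by simp
  qed
  show thesis
  proof
    \<comment> \<open>The fixed point satisfies 2 Z = X + Z^2, so I - Z squares to I - X.\<close>
    show "linear (\<lambda>x. x - Z x)"
      by (rule linear_compose_sub[OF linear_ident Z_lin])
    show "(x - Z x) - Z (x - Z x) = x - X x" for x
      using ZZ[of x] by (simp add: linear_diff[OF Z_lin] scaleR_2 algebra_simps)
    show "inner (x - Z x) y = inner x (y - Z y)" for x y
      by (simp add: inner_diff_left inner_diff_right Z_sym)
    show "0 \<le> inner (x - Z x) x" for x
    proof -
      have "inner (Z x) x \<le> norm x * norm x"
        by (meson Z_norm mult_right_mono norm_cauchy_schwarz norm_ge_zero order_trans)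
      then show ?thesis by (simp add: inner_diff_left power2_norm_eq_inner[symmetric] power2_eq_square)
    qed
  qed
qed

text \<open>The root is taken on the bounded side: B = G^(-1) satisfies 0 <= \<alpha> B <= I, so
  \<alpha> B = I - X with a contraction X and has a bounded root; rescaling gives Q with Q^2 = B,
  and the transposed graph of Q is the root of G.\<close>

lemma op_sqrt_exists:
  fixes G :: "'a::{real_inner, complete_space} unbounded_op"
  assumes G: "selfadjoint_op G" "op_ge G \<alpha>" "\<alpha> > 0"
  shows "\<exists>S. selfadjoint_op S \<and> op_ge S 0 \<and> S O S = G"
proof -
  note sv = selfadjoint_opD(2)[OF G(1)]
  obtain B where B: "linear B" "\<And>h. (B h, h) \<in> G" "\<And>x y. (x, y) \<in> G \<Longrightarrow> B y = x"
    by (rule selfadjoint_op_resolvent[OF G(1,2), of 1 0]) (use G(3) in auto)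
  have B_sym: "inner (B x) y = inner x (B y)" for x y
    using selfadjoint_op_inner[OF G(1) B(2)[of x] B(2)[of y]] by simp
  define X where "X x = x - \<alpha> *\<^sub>R B x" for x
  have "linear X" unfolding X_def by (intro linear_compose_sub linear_ident linear_compose_scale_right B(1))
  moreover have "norm (X x) \<le> norm x" for x
  proof -
    have "\<alpha> * (norm (B x))\<^sup>2 \<le> inner x (B x)" by (rule op_geD[OF G(2) sv B(2)])
    then have "\<alpha> * (\<alpha> * (norm (B x))\<^sup>2) \<le> \<alpha> * inner x (B x)" using G(3) by (intro mult_left_mono) auto
    moreover have "\<alpha> * (\<alpha> * (norm (B x))\<^sup>2) \<ge> 0" using G(3) by simp
    moreover have "(norm (X x))\<^sup>2 = (norm x)\<^sup>2 - 2 * (\<alpha> * inner x (B x)) + \<alpha> * (\<alpha> * (norm (B x))\<^sup>2)"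
      unfolding X_def power2_norm_eq_inner
      by (simp add: inner_diff_left inner_diff_right inner_commute algebra_simps)
    ultimately have "(norm (X x))\<^sup>2 \<le> (norm x)\<^sup>2" by linarith
    then show ?thesis by (rule power2_le_imp_le) simp
  qed
  moreover have "inner (X x) y = inner x (X y)" for x y
    by (simp add: X_def inner_diff_left inner_diff_right B_sym)
  ultimately obtain C where C: "linear C" "\<And>x. C (C x) = x - X x"
    "\<And>x y. inner (C x) y = inner x (C y)" "\<And>x. 0 \<le> inner (C x) x"
    by (rule sqrt_of_contraction_complement) blast
  define Q where "Q x = (1 / sqrt \<alpha>) *\<^sub>R C x" for x
  have Q_lin: "linear Q" unfolding Q_def by (rule linear_compose_scale_right[OF C(1)])
  have QQ: "Q (Q x) = B x" for x
    using G(3) by (simp add: Q_def linear_scale[OF C(1)] C(2) X_def)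
  have Q_sym: "inner (Q x) y = inner x (Q y)" for x y by (simp add: Q_def C(3))
  have Q_pos: "0 \<le> inner x (Q x)" for x using C(4)[of x] G(3) by (simp add: Q_def inner_commute)
  have Q_inj: "x = y" if "Q x = Q y" for x y
  proof -
    have "B x = B y" using that by (simp flip: QQ)
    then show ?thesis using B(2)[of x] B(2)[of y] sv by (auto simp: single_valued_def)
  qed
  define S where "S = {(Q x, x) |x. True}"
  have S_mem: "(x, y) \<in> S \<longleftrightarrow> x = Q y" for x y by (auto simp: S_def)
  have SS: "S O S = G"
  proof (intro subset_antisym subrelI)
    fix x z assume "(x, z) \<in> S O S"
    then have "x = B z" by (auto simp: S_mem QQ)
    then show "(x, z) \<in> G" by (simp add: B(2))
  next
    fix x z assume "(x, z) \<in> G"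
    from B(3)[OF this] have "(x, Q z) \<in> S" "(Q z, z) \<in> S" by (simp_all add: S_mem QQ)
    then show "(x, z) \<in> S O S" by (rule relcompI)
  qed
  have sub: "subspace S"
    unfolding subspace_def
    by (auto simp: S_def zero_prod_def linear_0[OF Q_lin] intro!: linear_add[OF Q_lin, symmetric] linear_scale[OF Q_lin, symmetric])
  have svS: "single_valued S" by (auto simp: single_valued_def S_mem dest: Q_inj)
  have "Domain G \<subseteq> Domain S" unfolding SS[symmetric] by blast
  then have dense: "closure (Domain S) = UNIV"
    using closure_mono selfadjoint_opD(3)[OF G(1)] by blast
  have adj: "adjoint_op S = S"
  proof (intro subset_antisym subrelI)
    fix y z assume "(y, z) \<in> adjoint_op S"
    then have "inner x y = inner (Q x) z" for x by (auto simp: adjoint_op_def S_def)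
    then have "inner (y - Q z) (y - Q z) = 0"
      by (simp add: Q_sym inner_diff_right)
    then show "(y, z) \<in> S" by (simp add: S_mem)
  next
    fix y z assume "(y, z) \<in> S"
    then show "(y, z) \<in> adjoint_op S" by (auto simp: adjoint_op_def S_def Q_sym)
  qed
  have "op_ge S 0"
    unfolding op_ge_def
  proof
    fix x assume "x \<in> Domain S"
    then obtain y where y: "(x, y) \<in> S" by blast
    then show "0 * (norm x)\<^sup>2 \<le> inner (S \<cdot> x) x"
      using op_apply_eq[OF svS y] Q_pos by (simp add: S_mem)
  qed
  then show ?thesis using sub svS dense adj SS by (auto simp: selfadjoint_op_def linear_op_def)
qed

text \<open>\<open>Q\<close> is read off from the graph of whichever root \<open>op_sqrt\<close>
  chooses. That graph is injective because a kernel vector of the root lies in the kernel of G, and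
  it is onto because G, the square of the root, is onto.\<close>

lemma op_sqrt_inverse:
  fixes G :: "'a::{real_inner, complete_space} unbounded_op"
  assumes G: "selfadjoint_op G" "op_ge G \<alpha>" "\<alpha> > 0"
  obtains Q where "linear Q" "\<And>x y. inner (Q x) y = inner x (Q y)" "\<And>x. (Q (Q x), x) \<in> G"
    "\<And>x y. (x, y) \<in> G \<Longrightarrow> Q (Q y) = x" "\<And>x. (op_sqrt G)\<inverse> \<cdot> x = Q x" "\<And>x. op_sqrt G \<cdot> Q x = x"
proof -
  have S: "selfadjoint_op (op_sqrt G)" "op_sqrt G O op_sqrt G = G"
    using someI_ex[OF op_sqrt_exists[OF G]] by (simp_all add: op_sqrt_def)
  let ?S = "op_sqrt G"
  note svS = selfadjoint_opD(2)[OF S(1)] and subS = selfadjoint_opD(1)[OF S(1)]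
  have inj: "x = x'" if "(x, y) \<in> ?S" "(x', y) \<in> ?S" for x x' y
  proof -
    have "(x, y) - (x', y) \<in> ?S" using that subS by (intro subspace_diff)
    then have "(x - x', 0) \<in> ?S" by simp
    moreover have "(0, 0) \<in> ?S" using subspace_0[OF subS] by (simp add: zero_prod_def)
    ultimately have "(x - x', 0) \<in> ?S O ?S" by blast
    then have "(x - x', 0) \<in> G" by (simp only: S(2))
    from op_geD[OF G(2) selfadjoint_opD(2)[OF G(1)] this] have "\<alpha> * (norm (x - x'))\<^sup>2 \<le> 0" by simp
    then show ?thesis using G(3) by (simp add: mult_le_0_iff)
  qed
  have "\<exists>x. (x, y) \<in> ?S" for y
  proof -
    obtain x where "(x, y) \<in> G"
      using selfadjoint_op_shift_surj[OF G(1,2), of 1 0 y] G(3) by (simp del: ex_simps) blast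
    then have "(x, y) \<in> ?S O ?S" by (simp add: S(2))
    then show ?thesis by blast
  qed
  then obtain Q where Q: "\<And>y. (Q y, y) \<in> ?S" by metis
  show thesis
  proof
    show "linear Q"
    proof (rule linearI)
      fix x y
      have "(Q x, x) + (Q y, y) \<in> ?S" using Q subS by (intro subspace_add)
      then show "Q (x + y) = Q x + Q y" by (intro inj[OF Q]) simp
    next
      fix r x
      have "r *\<^sub>R (Q x, x) \<in> ?S" using Q subS by (intro subspace_scale)
      then show "Q (r *\<^sub>R x) = r *\<^sub>R Q x" by (intro inj[OF Q]) simp
    qed
    show "inner (Q x) y = inner x (Q y)" for x y
      using selfadjoint_op_inner[OF S(1) Q[of x] Q[of y]] by simp
    show "(Q (Q x), x) \<in> G" for x
      using relcompI[OF Q[of "Q x"] Q[of x]] by (simp only: S(2))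
    show "Q (Q y) = x" if "(x, y) \<in> G" for x y
    proof -
      have "(x, y) \<in> ?S O ?S" using that by (simp only: S(2))
      then obtain w where "(x, w) \<in> ?S" "(w, y) \<in> ?S" by blast
      then show ?thesis using inj Q by blast
    qed
    show "?S\<inverse> \<cdot> x = Q x" for x
      by (rule op_apply_eq) (auto simp: single_valued_def Q intro: inj)
    show "?S \<cdot> Q x = x" for x by (rule op_apply_eq[OF svS Q])
  qed
qed

section \<open>Three-term recurrences driven by a symmetric contraction\<close>

text \<open>For k >= 1 this is L^((k-1)/2) U_(k-1)(L^(1/2)), with U the Chebyshev polynomials of the
  second kind; the recursion avoids the root of \<open>L\<close>.\<close>

fun cheb :: "('a::real_vector \<Rightarrow> 'a) \<Rightarrow> nat \<Rightarrow> 'a \<Rightarrow> 'a" where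
  "cheb L 0 x = 0"
| "cheb L (Suc 0) x = x"
| "cheb L (Suc (Suc k)) x = L (2 *\<^sub>R cheb L (Suc k) x - cheb L k x)"

lemma linear_cheb:
  assumes "linear L"
  shows "linear (cheb L k)"
proof (induction k rule: induct_nat_012)
  case 0
  show ?case by (intro linearI) auto
next
  case 1
  show ?case by (intro linearI) auto
next
  case (ge2 n)
  show ?case
    by (intro linearI) (simp_all add: linear_add[OF ge2(1)] linear_add[OF ge2(2)] linear_scale[OF ge2(1)]
      linear_scale[OF ge2(2)] linear_add[OF assms] linear_diff[OF assms] linear_scale[OF assms] algebra_simps)
qed

lemma cheb_commute:
  assumes "linear T" "\<And>x. T (L x) = L (T x)"
  shows "T (cheb L k x) = cheb L k (T x)"
  by (induction k rule: induct_nat_012)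
    (simp_all add: linear_0[OF assms(1)] linear_diff[OF assms(1)] linear_scale[OF assms(1)] assms(2))

text \<open>Discrete Duhamel formula: \<open>cheb\<close> is the response to the data (0, x), - L
  \<open>cheb\<close> shifted by one index is the response to (x, 0), and every source term acts as
  a fresh start with data (0, \<open>b i\<close>).\<close>

lemma three_term_recurrence:
  assumes L: "linear L"
    and x: "\<And>k. k < N \<Longrightarrow> x (Suc (Suc k)) = L (2 *\<^sub>R x (Suc k) - x k) + b (Suc k)"
    and k: "k \<le> N"
  shows "x (Suc k) = cheb L (Suc k) (x 1) - L (cheb L k (x 0)) + (\<Sum>i=1..k. cheb L (Suc k - i) (b i))"
  using k
proof (induction k rule: induct_nat_012)
  case 0
  then show ?case by (simp add: linear_0[OF L])
next
  case 1
  then show ?case using x[of 0] by (simp add: linear_diff[OF L] linear_scale[OF L])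
next
  case (ge2 n)
  define s2 where "s2 = (\<Sum>i=1..Suc n. cheb L (Suc (Suc n) - i) (b i))"
  define s1 where "s1 = (\<Sum>i=1..n. cheb L (Suc n - i) (b i))"
  have "(\<Sum>i=1..Suc n. cheb L (Suc (Suc (Suc n)) - i) (b i))
      = (\<Sum>i=1..Suc n. L (2 *\<^sub>R cheb L (Suc (Suc n) - i) (b i) - cheb L (Suc n - i) (b i)))"
    by (intro sum.cong) (auto simp: Suc_diff_le)
  also have "\<dots> = L (2 *\<^sub>R s2 - (\<Sum>i=1..Suc n. cheb L (Suc n - i) (b i)))"
    by (simp only: s2_def linear_sum[OF L, symmetric] sum_subtractf scaleR_sum_right)
  \<comment> \<open>The extra top term carries \<open>cheb L 0\<close>, which is zero.\<close>
  also have "(\<Sum>i=1..Suc n. cheb L (Suc n - i) (b i)) = s1"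
    by (simp add: s1_def sum.nat_ivl_Suc')
  finally have sum: "(\<Sum>i=1..Suc (Suc n). cheb L (Suc (Suc (Suc n)) - i) (b i))
      = b (Suc (Suc n)) + L (2 *\<^sub>R s2 - s1)"
    by (simp add: sum.nat_ivl_Suc'[of 1 "Suc n"])
  have IH: "x (Suc n) = cheb L (Suc n) (x 1) - L (cheb L n (x 0)) + s1"
    "x (Suc (Suc n)) = cheb L (Suc (Suc n)) (x 1) - L (cheb L (Suc n) (x 0)) + s2"
    unfolding s1_def s2_def by (intro ge2; use ge2(3) in simp)+
  show ?case
    unfolding sum x[OF Suc_le_lessD[OF ge2(3)]] IH cheb.simps(3)[of L "Suc n"]
      cheb.simps(3)[of L n "x 0"]
    by (simp only: linear_add[OF L] linear_diff[OF L] linear_scale[OF L]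
        scaleR_add_right scaleR_diff_right) (simp add: algebra_simps)
qed

text \<open>For symmetric \<open>L\<close> the condition \<open>sq\<close> reads L^2 <= L, which
  encodes 0 <= L <= I in a single inequality that is stable under averaging.\<close>

locale symmetric_contraction =
  fixes L :: "'a::real_inner \<Rightarrow> 'a"
  assumes lin: "linear L"
    and sym: "inner (L x) y = inner x (L y)"
    and sq: "(norm (L x))\<^sup>2 \<le> inner (L x) x"
begin

text \<open>The induction goes by two because one factor \<open>L\<close> can be moved to each side
  of the inner product; the base cases are L <= I and L^2 <= L.\<close>

lemma power_decreasing: "inner ((L ^^ Suc k) q) q \<le> inner ((L ^^ k) q) q"
proof (induction k arbitrary: q rule: induct_nat_012)
  case 0
  have "inner (L q) q \<le> norm (L q) * norm q" by (rule norm_cauchy_schwarz)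
  then have "(norm (L q))\<^sup>2 \<le> norm (L q) * norm q" using sq order_trans by blast
  then have "norm (L q) \<le> norm q"
    by (cases "L q = 0") (auto simp: power2_eq_square dest: mult_left_le_imp_le)
  then have "norm (L q) * norm q \<le> norm q * norm q" by (rule mult_right_mono) simp
  with \<open>inner (L q) q \<le> norm (L q) * norm q\<close> show ?case
    by (simp add: power2_norm_eq_inner[symmetric] power2_eq_square)
next
  case 1
  show ?case using sq[of q] by (simp add: sym[of "L q"] power2_norm_eq_inner)
next
  case (ge2 n)
  have "inner ((L ^^ Suc (Suc k)) q) q = inner ((L ^^ k) (L q)) (L q)" for k
    by (subst funpow.simps(2), simp only: o_apply sym)
      (simp only: funpow_Suc_right o_apply)
  then show ?case using ge2(1)[of "L q"] by metis
qed

lemma power_le: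
  assumes "i \<le> k"
  shows "inner ((L ^^ k) q) q \<le> inner ((L ^^ i) q) q"
  using assms
proof (induction rule: dec_induct)
  case (step n)
  then show ?case using power_decreasing[of n q] by linarith
qed simp

lemma linear_V: "linear (cheb L k)" by (rule linear_cheb[OF lin])

lemma L_cheb: "L (cheb L k x) = cheb L k (L x)" by (rule cheb_commute[OF lin]) (rule refl)

lemma cheb_cheb: "cheb L i (cheb L k x) = cheb L k (cheb L i x)"
  by (rule cheb_commute[OF linear_V]) (rule L_cheb[symmetric])

lemma cheb_sym: "inner (cheb L k x) y = inner x (cheb L k y)"
proof (induction k arbitrary: x y rule: induct_nat_012)
  case (ge2 n)
  have "inner (cheb L (Suc (Suc n)) x) y = inner (2 *\<^sub>R cheb L (Suc n) x - cheb L n x) (L y)"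
    by (simp add: sym)
  also have "\<dots> = inner x (2 *\<^sub>R cheb L (Suc n) (L y) - cheb L n (L y))"
    by (simp add: inner_diff_left inner_diff_right ge2)
  also have "\<dots> = inner x (cheb L (Suc (Suc n)) y)"
    by (simp add: linear_diff[OF lin] linear_scale[OF lin] L_cheb)
  finally show ?case .
qed auto

text \<open>A Cassini-type identity: by the recurrence, the quadratic expression at index k + 1 is
  \<open>L\<close> times the one at index k, and it starts from the identity. Paired with
  \<open>q\<close> it becomes the conserved energy of the scheme.\<close>

lemma cheb_identity:
  "cheb L (Suc k) (cheb L (Suc k) q) - 2 *\<^sub>R L (cheb L k (cheb L (Suc k) q)) + L (cheb L k (cheb L k q))
    = (L ^^ k) q"
proof (induction k)
  case 0
  then show ?case by (simp add: linear_0[OF lin])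
next
  case (Suc k)
  let ?b = "cheb L (Suc k)" and ?c = "cheb L k"
  note lins = linear_diff[OF lin] linear_scale[OF lin] linear_add[OF lin]
    linear_diff[OF linear_V] linear_scale[OF linear_V] linear_add[OF linear_V]
  have a: "cheb L (Suc (Suc k)) x = 2 *\<^sub>R L (?b x) - L (?c x)" for x by (simp add: lins)
  have "cheb L (Suc (Suc k)) (cheb L (Suc (Suc k)) q)
      - 2 *\<^sub>R L (?b (cheb L (Suc (Suc k)) q)) + L (?b (?b q))
    = L (?b (?b q) - 2 *\<^sub>R L (?c (?b q)) + L (?c (?c q)))"
    unfolding a
    by (simp only: lins L_cheb[symmetric] cheb_cheb[of "Suc k" k])
      (simp add: algebra_simps lins flip: scaleR_add_left)
  then show ?case by (simp add: Suc)
qed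

lemma cheb_energy:
  "(norm (cheb L (Suc k) q))\<^sup>2 - 2 * inner (L (cheb L k q)) (cheb L (Suc k) q)
      + inner (L (cheb L k q)) (cheb L k q) = inner ((L ^^ k) q) q"
proof -
  have 1: "inner (cheb L (Suc k) (cheb L (Suc k) q)) q = (norm (cheb L (Suc k) q))\<^sup>2"
    by (simp only: cheb_sym power2_norm_eq_inner)
  have 2: "inner (L (cheb L k (cheb L i q))) q = inner (L (cheb L k q)) (cheb L i q)" for i
    by (simp only: sym cheb_sym L_cheb)
      (simp only: cheb_cheb[of i k])
  show ?thesis
    unfolding cheb_identity[symmetric] by (simp only: inner_add_left inner_diff_left inner_scaleR_left 1 2)
qed

lemma inner_L_nonneg: "0 \<le> inner (L x) x"
  using sq[of x] by (meson order_trans zero_le_power2)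

text \<open>The vector is the solution with equal data x_0 = x_1 = q, so it later carries the
  contribution of z_0. Completing the square in the energy, with L^2 <= L for the last term, bounds
  it without any factor 1 / \<tau>.\<close>

lemma cheb_velocity_le: "norm (cheb L (Suc k) q - L (cheb L k q)) \<le> norm q"
proof (rule power2_le_imp_le)
  have "(norm (cheb L (Suc k) q - L (cheb L k q)))\<^sup>2 = (norm (cheb L (Suc k) q))\<^sup>2
      - 2 * inner (L (cheb L k q)) (cheb L (Suc k) q) + (norm (L (cheb L k q)))\<^sup>2"
    unfolding power2_norm_eq_inner by (simp add: inner_diff_left inner_diff_right inner_commute)
  also have "\<dots> \<le> inner ((L ^^ k) q) q" using cheb_energy[of k q] sq[of "cheb L k q"] by linarith
  also have "\<dots> \<le> (norm q)\<^sup>2" using power_le[of 0 k q] by (simp add: power2_norm_eq_inner)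
  finally show "(norm (cheb L (Suc k) q - L (cheb L k q)))\<^sup>2 \<le> (norm q)\<^sup>2" .
qed simp

text \<open>Here the mixed term of the energy is removed by the other square, the form of
  \<open>L\<close> at the difference of consecutive values. The power of \<open>L\<close> is kept on
  the right because \<open>cheb_gap\<close> spends one factor of it.\<close>

lemma cheb_potential_le_power:
  "inner (cheb L (Suc k) q - L (cheb L (Suc k) q)) (cheb L (Suc k) q) \<le> inner ((L ^^ k) q) q"
proof -
  let ?p = "cheb L (Suc k) q" and ?w = "cheb L k q"
  have sw: "inner (L ?p) ?w = inner (L ?w) ?p" by (metis sym inner_commute)
  have "0 \<le> inner (L (?p - ?w)) (?p - ?w)" by (rule inner_L_nonneg)
  then have "0 \<le> inner (L ?p) ?p - 2 * inner (L ?w) ?p + inner (L ?w) ?w"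
    using sw by (simp add: linear_diff[OF lin] inner_diff_left inner_diff_right)
  with cheb_energy[of k q] show ?thesis by (simp add: inner_diff_left power2_norm_eq_inner)
qed

lemma cheb_potential_le: "inner (cheb L k q - L (cheb L k q)) (cheb L k q) \<le> (norm q)\<^sup>2"
proof (cases k)
  case (Suc i)
  then show ?thesis
    using cheb_potential_le_power[of i q] power_le[of 0 i q] by (simp add: power2_norm_eq_inner)
qed simp

text \<open>Multiplying the potential bound by 1 + s leaves s times the squared norm on the left and
  at most the squared norm of \<open>q\<close> on the right, provided the right side still contains
  a factor \<open>L\<close>. Hence the index starts at 2: for index 1 the polynomial is the identity
  and the claim would force s <= 1.\<close>

lemma cheb_gap:
  assumes gap: "\<And>x. (1 + s) * inner (L x) x \<le> (norm x)\<^sup>2" and s: "0 \<le> s"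
  shows "s * (norm (cheb L (Suc (Suc k)) q))\<^sup>2 \<le> (norm q)\<^sup>2"
proof -
  let ?p = "cheb L (Suc (Suc k)) q"
  have "(norm ?p)\<^sup>2 - inner (L ?p) ?p \<le> inner (L q) q"
    using cheb_potential_le_power[of "Suc k" q] power_le[of 1 "Suc k" q]
    by (simp del: cheb.simps add: inner_diff_left power2_norm_eq_inner)
  then have "(1 + s) * ((norm ?p)\<^sup>2 - inner (L ?p) ?p) \<le> (1 + s) * inner (L q) q"
    using s by (intro mult_left_mono) auto
  then show ?thesis using gap[of ?p] gap[of q] by (simp del: cheb.simps add: algebra_simps)
qed

text \<open>Duality through the symmetry of \<open>cheb\<close>: it suffices to test
  \<open>y\<close> against vectors of the form \<open>cheb L k q\<close>, for which the energy
  bounds are available.\<close>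

lemma norm_cheb_leI:
  assumes K: "0 \<le> K" and weak: "\<And>q. inner y (cheb L k q) \<le> K * norm q"
  shows "norm (cheb L k y) \<le> K"
proof (cases "cheb L k y = 0")
  case False
  have "norm (cheb L k y) * norm (cheb L k y) \<le> K * norm (cheb L k y)"
    using weak[of "cheb L k y"] by (simp add: cheb_sym[symmetric] power2_norm_eq_inner[symmetric] power2_eq_square)
  then show ?thesis using False by simp
qed (simp add: K)

end

section \<open>Tools: quadratic forms, weak integrals, Gronwall\<close>

lemma form_cauchy_schwarz:
  fixes P :: "'a::real_inner \<Rightarrow> 'a"
  assumes P: "linear P" "\<And>x y. inner (P x) y = inner x (P y)" "\<And>x. 0 \<le> inner (P x) x"
  shows "(inner (P x) y)\<^sup>2 \<le> inner (P x) x * inner (P y) y"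
proof -
  let ?a = "inner (P x) x" and ?b = "inner (P x) y" and ?c = "inner (P y) y"
  have q: "0 \<le> ?a - 2 * s * ?b + s\<^sup>2 * ?c" for s
  proof -
    have "0 \<le> inner (P (x - s *\<^sub>R y)) (x - s *\<^sub>R y)" by (rule P(3))
    also have "\<dots> = ?a - 2 * s * ?b + s\<^sup>2 * ?c"
      using P(2)[of y x] by (simp add: linear_diff[OF P(1)] linear_scale[OF P(1)] inner_diff_left inner_diff_right
        inner_commute power2_eq_square algebra_simps)
    finally show ?thesis .
  qed
  show ?thesis
  proof (cases "?c = 0")
    case True
    have "?b = 0"
    proof (rule ccontr)
      assume "?b \<noteq> 0"
      \<comment> \<open>At this value of \<open>s\<close> the expression in \<open>q\<close> equals
        -1.\<close>
      then show False using q[of "(?a + 1) / (2 * ?b)"] True by simp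
    qed
    then show ?thesis by (simp add: True)
  next
    case False
    then have c: "?c > 0" using P(3)[of y] by linarith
    have "0 \<le> ?c * (?a - 2 * (?b / ?c) * ?b + (?b / ?c)\<^sup>2 * ?c)"
      using q[of "?b / ?c"] c by (intro mult_nonneg_nonneg) auto
    also have "\<dots> = ?a * ?c - ?b\<^sup>2" using c by (simp add: field_simps power2_eq_square)
    finally show ?thesis by simp
  qed
qed

text \<open>A weak integral: the type of the Hilbert space is not of class \<^class>\<open>banach\<close>, so the library's
  vector-valued integral is not available on it.\<close>

lemma norm_le_weak_integral:
  fixes T T' :: "'a::real_inner \<Rightarrow> 'a" and g :: "real \<Rightarrow> 'a"
  assumes E: "\<And>\<phi>. ((\<lambda>s. inner (g s) \<phi>) has_integral inner E \<phi>) {a..b}"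
    and adj: "\<And>x y. inner (T x) y = inner x (T' y)"
    and bound: "\<And>s. s \<in> {a..b} \<Longrightarrow> norm (T (g s)) \<le> N s" and N: "N integrable_on {a..b}"
  shows "norm (T E) \<le> integral {a..b} N"
proof -
  have nn: "0 \<le> integral {a..b} N"
    by (rule integral_nonneg[OF N]) (meson bound norm_ge_zero order_trans)
  have "norm (T E) * norm (T E) = inner E (T' (T E))"
    by (simp add: adj[symmetric] power2_norm_eq_inner[symmetric] power2_eq_square)
  also have "\<dots> \<le> integral {a..b} N * norm (T E)"
  proof (rule has_integral_le[OF E has_integral_mult_left[OF integrable_integral[OF N]]])
    fix s assume s: "s \<in> {a..b}"
    have "inner (g s) (T' (T E)) = inner (T (g s)) (T E)" by (simp add: adj)
    also have "\<dots> \<le> norm (T (g s)) * norm (T E)" by (rule norm_cauchy_schwarz)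
    also have "\<dots> \<le> N s * norm (T E)" by (intro mult_right_mono bound s) simp
    finally show "inner (g s) (T' (T E)) \<le> N s * norm (T E)" .
  qed
  finally show ?thesis using nn by (cases "T E = 0") auto
qed

text \<open>Taylor's formula with the hat function as kernel. Each half of the hat is linear, so
  integration by parts gives an explicit antiderivative, and the two boundary terms with
  \<open>h' a\<close> cancel at the peak.\<close>

lemma second_difference_has_integral:
  fixes h h' h'' :: "real \<Rightarrow> real"
  assumes r: "r > 0"
    and h: "\<And>s. s \<in> {a - r..a + r} \<Longrightarrow> (h has_vector_derivative h' s) (at s within {a - r..a + r})"
    and h': "\<And>s. s \<in> {a - r..a + r} \<Longrightarrow> (h' has_vector_derivative h'' s) (at s within {a - r..a + r})"
  shows "((\<lambda>s. (r - \<bar>s - a\<bar>) * h'' s) has_integral h (a + r) - 2 * h a + h (a - r)) {a - r..a + r}"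
proof -
  have left: "((\<lambda>s. (r - \<bar>s - a\<bar>) * h'' s) has_integral r * h' a - h a + h (a - r)) {a - r..a}"
  proof -
    have "((\<lambda>s. (s - (a - r)) * h'' s) has_integral
        ((a - (a - r)) * h' a - h a) - (((a - r) - (a - r)) * h' (a - r) - h (a - r))) {a - r..a}"
    proof (rule fundamental_theorem_of_calculus)
      fix s assume "s \<in> {a - r..a}"
      then have s: "s \<in> {a - r..a + r}" "{a - r..a} \<subseteq> {a - r..a + r}" using r by auto
      note d = has_vector_derivative_within_subset[OF _ s(2)]
      show "((\<lambda>s. (s - (a - r)) * h' s - h s) has_vector_derivative (s - (a - r)) * h'' s) (at s within {a - r..a})"
        using d[OF h[OF s(1)]] d[OF h'[OF s(1)]]
        unfolding has_real_derivative_iff_has_vector_derivative[symmetric]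
        by (auto intro!: derivative_eq_intros)
    qed (use r in auto)
    then have "((\<lambda>s. (s - (a - r)) * h'' s) has_integral r * h' a - h a + h (a - r)) {a - r..a}" by simp
    then show ?thesis by (rule has_integral_eq[rotated]) auto
  qed
  have right: "((\<lambda>s. (r - \<bar>s - a\<bar>) * h'' s) has_integral h (a + r) - h a - r * h' a) {a..a + r}"
  proof -
    have "((\<lambda>s. (a + r - s) * h'' s) has_integral
        ((a + r - (a + r)) * h' (a + r) + h (a + r)) - ((a + r - a) * h' a + h a)) {a..a + r}"
    proof (rule fundamental_theorem_of_calculus)
      fix s assume "s \<in> {a..a + r}"
      then have s: "s \<in> {a - r..a + r}" "{a..a + r} \<subseteq> {a - r..a + r}" using r by auto
      note d = has_vector_derivative_within_subset[OF _ s(2)]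
      show "((\<lambda>s. (a + r - s) * h' s + h s) has_vector_derivative (a + r - s) * h'' s) (at s within {a..a + r})"
        using d[OF h[OF s(1)]] d[OF h'[OF s(1)]]
        unfolding has_real_derivative_iff_has_vector_derivative[symmetric]
        by (auto intro!: derivative_eq_intros)
    qed (use r in auto)
    then have "((\<lambda>s. (a + r - s) * h'' s) has_integral h (a + r) - h a - r * h' a) {a..a + r}"
      by (simp add: algebra_simps)
    then show ?thesis by (rule has_integral_eq[rotated]) auto
  qed
  from has_integral_combine[OF _ _ left right] r show ?thesis by (simp add: algebra_simps)
qed

lemma discrete_gronwall:
  fixes e d :: "nat \<Rightarrow> real"
  assumes q: "0 \<le> q" and d: "\<And>i j. i \<le> j \<Longrightarrow> d i \<le> d j" "\<And>i. 0 \<le> d i"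
    and e: "\<And>k. k < N \<Longrightarrow> e k \<le> d k + q * (\<Sum>i<k. e i)" and k: "k < N"
  shows "e k \<le> (1 + q) ^ k * d k"
  using k
proof (induction k rule: less_induct)
  case (less k)
  have "(\<Sum>i<k. e i) \<le> (\<Sum>i<k. (1 + q) ^ i * d k)"
  proof (rule sum_mono)
    fix i assume i: "i \<in> {..<k}"
    then have "e i \<le> (1 + q) ^ i * d i" using less by auto
    also have "\<dots> \<le> (1 + q) ^ i * d k" using i q d by (intro mult_left_mono) auto
    finally show "e i \<le> (1 + q) ^ i * d k" .
  qed
  from mult_left_mono[OF this q] have "e k \<le> d k + q * (\<Sum>i<k. (1 + q) ^ i * d k)"
    using e[OF less.prems] by linarith
  also have "\<dots> = (1 + q * (\<Sum>i<k. (1 + q) ^ i)) * d k"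
    unfolding sum_distrib_right[symmetric] by (simp add: algebra_simps)
  also have "1 + q * (\<Sum>i<k. (1 + q) ^ i) = (1 + q) ^ k"
    using power_diff_1_eq[of "1 + q" k] by simp
  finally show ?case .
qed

section \<open>Stability and consistency of the splitting resolvents\<close>

text \<open>The dictionary: \<open>Q = A\<^sup>-\<^sup>1\<^sup>/\<^sup>2\<close>, \<open>C j = A\<^sub>j A\<^sup>-\<^sup>1\<close>, \<open>P j = (I + \<tau>\<^sup>2 \<eta>\<^sub>j\<^sup>-\<^sup>1 A\<^sub>j)\<^sup>-\<^sup>1\<close> and
  \<open>R = (I + \<tau>\<^sup>2 A)\<^sup>-\<^sup>1\<close>. Elements of \<open>D(A)\<close> appear as \<open>Q (Q p)\<close> with \<open>p = A u\<close>.\<close>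

locale splitting_resolvents =
  fixes m :: nat and \<eta> a' :: "nat \<Rightarrow> real" and \<tau> \<nu> :: real
    and Q R :: "'a::real_inner \<Rightarrow> 'a" and C P :: "nat \<Rightarrow> 'a \<Rightarrow> 'a"
  assumes eta: "\<And>j. j \<in> {1..m} \<Longrightarrow> 0 < \<eta> j \<and> \<eta> j < 1" "(\<Sum>j=1..m. \<eta> j) = 1"
    and tau: "\<tau> > 0" and nu: "\<nu> > 0"
    and Q: "linear Q" "\<And>x y. inner (Q x) y = inner x (Q y)"
    and C: "\<And>j. j \<in> {1..m} \<Longrightarrow> linear (C j)" "\<And>p. (\<Sum>j=1..m. C j p) = p"
      "\<And>j p. j \<in> {1..m} \<Longrightarrow> 0 \<le> inner (C j p) (Q (Q p))"
      "\<And>j p. j \<in> {1..m} \<Longrightarrow> norm (C j p) \<le> a' j * norm p"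
      "\<And>j. j \<in> {1..m} \<Longrightarrow> 0 \<le> a' j"
    and P: "\<And>j. j \<in> {1..m} \<Longrightarrow> linear (P j)"
      "\<And>j x y. j \<in> {1..m} \<Longrightarrow> inner (P j x) y = inner x (P j y)"
      "\<And>j x. j \<in> {1..m} \<Longrightarrow> \<tau>\<^sup>2 * \<nu> * (norm (P j x))\<^sup>2 \<le> \<eta> j * inner (P j x) (x - P j x)"
      "\<And>j p. j \<in> {1..m} \<Longrightarrow> \<eta> j *\<^sub>R (Q (Q p) - P j (Q (Q p))) = \<tau>\<^sup>2 *\<^sub>R P j (C j p)"
    and R: "linear R" "\<And>h. \<tau>\<^sup>2 *\<^sub>R R h = Q (Q (h - R h))" "\<And>p. R (Q (Q p) + \<tau>\<^sup>2 *\<^sub>R p) = Q (Q p)"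
begin

section \<open>The resolvents of the summands and their weighted average\<close>

definition L :: "'a \<Rightarrow> 'a" where "L x = (\<Sum>j=1..m. \<eta> j *\<^sub>R P j x)"

definition c0 :: real where "c0 = (\<Sum>j=1..m. a' j / sqrt (\<eta> j))"

definition c2 :: real where "c2 = real m + c0"

lemma m_pos: "1 \<in> {1..m}"
  using eta(2) by (cases m) auto

lemma C_sum: "(\<Sum>j=Suc 0..m. C j p) = p"
  using C(2) by simp

lemma c0_nonneg: "0 \<le> c0"
  unfolding c0_def using eta(1) C(5) by (intro sum_nonneg divide_nonneg_nonneg) (auto intro: less_imp_le)

text \<open>Assumption \<open>P(3)\<close> is A_j >= \<nu> tested at \<open>P j x\<close>, because
  A_j P_j x = (\<eta>_j / \<tau>^2) (x - P_j x). The factor \<eta>_j < 1 may be dropped on the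
  larger side.\<close>

lemma P_coercive:
  assumes j: "j \<in> {1..m}"
  shows "(1 + \<tau>\<^sup>2 * \<nu>) * (norm (P j x))\<^sup>2 \<le> inner (P j x) x"
proof -
  let ?i = "inner (P j x) (x - P j x)"
  have s: "0 \<le> \<tau>\<^sup>2 * \<nu> * (norm (P j x))\<^sup>2" using nu by simp
  then have "0 \<le> \<eta> j * ?i" using P(3)[OF j, of x] by linarith
  then have "0 \<le> ?i" using eta(1)[OF j] by (simp add: zero_le_mult_iff)
  then have "\<eta> j * ?i \<le> 1 * ?i" using eta(1)[OF j] by (intro mult_right_mono) auto
  then have "\<tau>\<^sup>2 * \<nu> * (norm (P j x))\<^sup>2 \<le> ?i" using P(3)[OF j, of x] by linarith
  then show ?thesis by (simp add: inner_diff_right power2_norm_eq_inner algebra_simps)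
qed

lemma P_norm:
  assumes j: "j \<in> {1..m}"
  shows "(1 + \<tau>\<^sup>2 * \<nu>) * norm (P j x) \<le> norm x"
proof (cases "P j x = 0")
  case False
  have "((1 + \<tau>\<^sup>2 * \<nu>) * norm (P j x)) * norm (P j x) \<le> norm x * norm (P j x)"
    using P_coercive[OF j, of x] norm_cauchy_schwarz[of "P j x" x]
    by (simp add: power2_eq_square algebra_simps)
  then show ?thesis using False by simp
qed simp

lemma P_contraction:
  assumes j: "j \<in> {1..m}"
  shows "norm (P j x) \<le> norm x"
proof -
  have "1 * norm (P j x) \<le> (1 + \<tau>\<^sup>2 * \<nu>) * norm (P j x)"
    using nu by (intro mult_right_mono) auto
  then show ?thesis using P_norm[OF j, of x] by simp
qed

lemma P_inner_bounds:
  assumes j: "j \<in> {1..m}"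
  shows "(norm (P j x))\<^sup>2 \<le> inner (P j x) x" "0 \<le> inner (P j x) x" "0 \<le> inner (x - P j x) x"
    "(1 + \<tau>\<^sup>2 * \<nu>) * inner (P j x) x \<le> (norm x)\<^sup>2"
proof -
  have "1 * (norm (P j x))\<^sup>2 \<le> (1 + \<tau>\<^sup>2 * \<nu>) * (norm (P j x))\<^sup>2"
    using nu by (intro mult_right_mono) auto
  then show 1: "(norm (P j x))\<^sup>2 \<le> inner (P j x) x" using P_coercive[OF j, of x] by simp
  then show "0 \<le> inner (P j x) x" by (meson order_trans zero_le_power2)
  have "(1 + \<tau>\<^sup>2 * \<nu>) * inner (P j x) x \<le> (1 + \<tau>\<^sup>2 * \<nu>) * (norm (P j x) * norm x)"
    using nu by (intro mult_left_mono norm_cauchy_schwarz) auto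
  also have "\<dots> = ((1 + \<tau>\<^sup>2 * \<nu>) * norm (P j x)) * norm x" by simp
  also have "\<dots> \<le> norm x * norm x" by (intro mult_right_mono P_norm[OF j]) simp
  finally show "(1 + \<tau>\<^sup>2 * \<nu>) * inner (P j x) x \<le> (norm x)\<^sup>2" by (simp add: power2_eq_square)
  have "inner (P j x) x \<le> norm (P j x) * norm x" by (rule norm_cauchy_schwarz)
  also have "\<dots> \<le> norm x * norm x" by (intro mult_right_mono P_contraction[OF j]) simp
  finally show "0 \<le> inner (x - P j x) x"
    by (simp add: inner_diff_left power2_norm_eq_inner[symmetric] power2_eq_square)
qed

lemma linear_L: "linear L"
  unfolding L_def by (intro linear_compose_sum linear_compose_scale_right ballI P(1)) auto

lemma L_inner: "inner (L x) y = (\<Sum>j=1..m. \<eta> j * inner (P j x) y)"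
  by (simp add: L_def inner_sum_left)

lemma complement_L: "x - L x = (\<Sum>j=1..m. \<eta> j *\<^sub>R (x - P j x))"
proof -
  have "x = (\<Sum>j=1..m. \<eta> j *\<^sub>R x)" by (simp only: scaleR_left.sum[symmetric] eta(2) scaleR_one)
  then show ?thesis by (simp add: L_def scaleR_diff_right sum_subtractf)
qed

lemma L_gap: "(1 + \<tau>\<^sup>2 * \<nu>) * inner (L x) x \<le> (norm x)\<^sup>2"
proof -
  have "(1 + \<tau>\<^sup>2 * \<nu>) * inner (L x) x = (\<Sum>j=1..m. \<eta> j * ((1 + \<tau>\<^sup>2 * \<nu>) * inner (P j x) x))"
    by (simp add: L_inner sum_distrib_left mult.left_commute)
  also have "\<dots> \<le> (\<Sum>j=1..m. \<eta> j * (norm x)\<^sup>2)"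
    by (intro sum_mono mult_left_mono P_inner_bounds(4)) (use eta in \<open>auto intro: less_imp_le\<close>)
  also have "\<dots> = (norm x)\<^sup>2" by (simp only: sum_distrib_right[symmetric] eta(2) mult_1)
  finally show ?thesis .
qed

sublocale symmetric_contraction L
proof (rule symmetric_contraction.intro)
  show "linear L" by (rule linear_L)
  show "inner (L x) y = inner x (L y)" for x y
    unfolding L_def inner_sum_left inner_sum_right by (intro sum.cong) (simp_all add: P(2))
  show "(norm (L x))\<^sup>2 \<le> inner (L x) x" for x
  proof -
    \<comment> \<open>The weighted variance of the vectors \<open>P j x\<close> about their mean
      \<open>L x\<close>; expanding it is the convexity of the squared norm.\<close>
    have "0 \<le> (\<Sum>j=1..m. \<eta> j * (norm (P j x - L x))\<^sup>2)"
      using eta(1) by (intro sum_nonneg mult_nonneg_nonneg) (auto intro: less_imp_le)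
    also have "\<dots> = (\<Sum>j=1..m. \<eta> j * (norm (P j x))\<^sup>2 - 2 * (\<eta> j * inner (P j x) (L x)) + \<eta> j * (norm (L x))\<^sup>2)"
      by (intro sum.cong) (simp_all add: power2_norm_eq_inner inner_diff_left inner_diff_right
        inner_commute algebra_simps)
    also have "\<dots> = (\<Sum>j=1..m. \<eta> j * (norm (P j x))\<^sup>2) - 2 * inner (L x) (L x) + (norm (L x))\<^sup>2"
      by (simp only: sum.distrib sum_subtractf sum_distrib_left[symmetric] sum_distrib_right[symmetric] eta(2) L_inner mult_1)
    finally have "(norm (L x))\<^sup>2 \<le> (\<Sum>j=1..m. \<eta> j * (norm (P j x))\<^sup>2)"
      by (simp add: power2_norm_eq_inner)
    also have "\<dots> \<le> (\<Sum>j=1..m. \<eta> j * inner (P j x) x)"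
      by (intro sum_mono mult_left_mono P_inner_bounds(1)) (use eta in \<open>auto intro: less_imp_le\<close>)
    finally show ?thesis by (simp add: L_inner)
  qed
qed

section \<open>Absorbing half a power of the summands\<close>

abbreviation V :: "nat \<Rightarrow> 'a \<Rightarrow> 'a" where "V \<equiv> cheb L"

lemmas V_lin = linear_add[OF linear_V] linear_diff[OF linear_V] linear_scale[OF linear_V]
  linear_sum[OF linear_V] linear_0[OF linear_V]

text \<open>The bound keeps the form of I - P_j at \<open>x\<close>: \<open>V_complement\<close>
  estimates it by the norm of \<open>x\<close>, \<open>V_P_C\<close> by the energy of A. It is
  Cauchy-Schwarz for that form, whose value at \<open>V k q\<close> is a part of the potential
  energy.\<close>

lemma V_complement_energy:
  assumes j: "j \<in> {1..m}"
  shows "norm (V k (x - P j x)) \<le> sqrt (inner (x - P j x) x / \<eta> j)"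
proof (rule norm_cheb_leI)
  show "0 \<le> sqrt (inner (x - P j x) x / \<eta> j)" using P_inner_bounds(3)[OF j, of x] eta(1)[OF j] by simp
  fix q
  let ?p = "V k q" and ?D = "\<lambda>x. x - P j x"
  have "\<eta> j * inner (?D ?p) ?p \<le> (\<Sum>i=1..m. \<eta> i * inner (?p - P i ?p) ?p)"
    using j P_inner_bounds(3) eta(1)
    by (intro member_le_sum[of j _ "\<lambda>i. \<eta> i * inner (?p - P i ?p) ?p"]) (auto intro!: mult_nonneg_nonneg intro: less_imp_le)
  also have "\<dots> = inner (?p - L ?p) ?p" by (simp add: complement_L inner_sum_left)
  also have "\<dots> \<le> (norm q)\<^sup>2" by (rule cheb_potential_le)
  finally have pq: "inner (?D ?p) ?p \<le> (norm q)\<^sup>2 / \<eta> j" using eta(1)[OF j] by (simp add: field_simps)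
  have "(inner (?D x) ?p)\<^sup>2 \<le> inner (?D x) x * inner (?D ?p) ?p"
  proof (rule form_cauchy_schwarz)
    show "linear ?D" by (intro linear_compose_sub linear_ident P(1) j)
    show "inner (?D x) y = inner x (?D y)" for x y
      by (simp add: inner_diff_left inner_diff_right P(2)[OF j])
  qed (rule P_inner_bounds(3)[OF j])
  also have "\<dots> \<le> inner (?D x) x * ((norm q)\<^sup>2 / \<eta> j)" by (intro mult_left_mono pq P_inner_bounds(3) j)
  finally have "\<bar>inner (?D x) ?p\<bar> \<le> sqrt (inner (?D x) x / \<eta> j * (norm q)\<^sup>2)"
    by (intro real_le_rsqrt) (simp add: field_simps)
  then show "inner (?D x) ?p \<le> sqrt (inner (?D x) x / \<eta> j) * norm q"
    unfolding real_sqrt_mult by simp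
qed

lemma V_complement:
  assumes j: "j \<in> {1..m}"
  shows "norm (V k (x - P j x)) \<le> norm x / sqrt (\<eta> j)"
proof -
  have "inner (x - P j x) x / \<eta> j \<le> (norm x)\<^sup>2 / \<eta> j"
    using P_inner_bounds(2)[OF j, of x] eta(1)[OF j]
    by (intro divide_right_mono) (auto simp: inner_diff_left power2_norm_eq_inner)
  then have "sqrt (inner (x - P j x) x / \<eta> j) \<le> norm x / sqrt (\<eta> j)"
    using real_sqrt_le_mono by (fastforce simp: real_sqrt_divide)
  then show ?thesis using V_complement_energy[OF j] order_trans by blast
qed

text \<open>With g = A^(-1) p, the vector is (\<eta>_j / \<tau>) (I - P_j) g, and the form of I -
  P_j at g is at most (\<tau>^2 / \<eta>_j) (A_j g, g), hence at most (\<tau>^2 / \<eta>_j) (A g,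
  g), where (A g, g) is the squared norm of Q p. All powers of \<tau> and \<eta>_j then
  cancel.\<close>

lemma V_P_C:
  assumes j: "j \<in> {1..m}"
  shows "norm (V k (\<tau> *\<^sub>R P j (C j p))) \<le> norm (Q p)"
proof -
  let ?g = "Q (Q p)"
  have e: "\<eta> j > 0" using eta(1)[OF j] by simp
  have eq: "\<tau> *\<^sub>R P j (C j p) = (\<eta> j / \<tau>) *\<^sub>R (?g - P j ?g)"
  proof -
    have "(\<eta> j / \<tau>) *\<^sub>R (?g - P j ?g) = (1 / \<tau>) *\<^sub>R (\<eta> j *\<^sub>R (?g - P j ?g))" by simp
    also have "\<dots> = \<tau> *\<^sub>R P j (C j p)" unfolding P(4)[OF j] using tau by (simp add: power2_eq_square)
    finally show ?thesis by simp
  qed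
  have "\<eta> j * inner (?g - P j ?g) ?g = \<tau>\<^sup>2 * inner (P j (C j p)) ?g"
    using arg_cong[OF P(4)[OF j, of p], of "\<lambda>w. inner w ?g"] by simp
  also have "inner (P j (C j p)) ?g = inner (C j p) ?g - inner (C j p) (?g - P j ?g)"
    by (simp add: P(2)[OF j] inner_diff_right)
  also have "\<tau>\<^sup>2 * \<dots> \<le> \<tau>\<^sup>2 * inner (C j p) ?g"
  proof (rule mult_left_mono)
    \<comment> \<open>The discarded term is a nonnegative multiple of the form of \<open>P j\<close>
      at \<open>C j p\<close>.\<close>
    have "\<eta> j * inner (C j p) (?g - P j ?g) = \<tau>\<^sup>2 * inner (P j (C j p)) (C j p)"
      using arg_cong[OF P(4)[OF j, of p], of "\<lambda>w. inner (C j p) w"] by (simp add: inner_commute)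
    also have "\<dots> \<ge> 0" using P_inner_bounds(2)[OF j] by simp
    finally show "inner (C j p) ?g - inner (C j p) (?g - P j ?g) \<le> inner (C j p) ?g"
      using e by (simp add: zero_le_mult_iff)
  qed simp
  also have "\<dots> \<le> \<tau>\<^sup>2 * (norm (Q p))\<^sup>2"
  proof (rule mult_left_mono)
    \<comment> \<open>A_j <= A as forms, since the other summands are nonnegative.\<close>
    have "inner (C j p) ?g \<le> (\<Sum>i=1..m. inner (C i p) ?g)"
      using j C(3) by (intro member_le_sum[of j _ "\<lambda>i. inner (C i p) ?g"]) auto
    also have "\<dots> = inner p ?g" by (simp add: inner_sum_left[symmetric] C_sum)
    also have "\<dots> = (norm (Q p))\<^sup>2" by (simp add: Q(2)[symmetric] power2_norm_eq_inner)
    finally show "inner (C j p) ?g \<le> (norm (Q p))\<^sup>2" .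
  qed simp
  finally have "inner (?g - P j ?g) ?g / \<eta> j \<le> (\<tau> * norm (Q p) / \<eta> j)\<^sup>2"
    using e by (simp add: power_divide power_mult_distrib) (simp add: field_simps power2_eq_square)
  then have "sqrt (inner (?g - P j ?g) ?g / \<eta> j) \<le> \<tau> * norm (Q p) / \<eta> j"
    using e tau by (intro real_le_lsqrt) auto
  then have "norm (V k (?g - P j ?g)) \<le> \<tau> * norm (Q p) / \<eta> j"
    using V_complement_energy[OF j] order_trans by blast
  then have "(\<eta> j / \<tau>) * norm (V k (?g - P j ?g)) \<le> (\<eta> j / \<tau>) * (\<tau> * norm (Q p) / \<eta> j)"
    using e tau by (intro mult_left_mono) auto
  then show ?thesis unfolding eq V_lin using e tau by simp
qed

text \<open>Write p as the sum of the \<open>C j p\<close> and insert the resolvent into each term: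
  the resolved parts cost \<open>norm (Q p)\<close> apiece, the complements cost a_j / sqrt \<eta>_j
  times the full norm.\<close>

lemma V_tau:
  "norm (V k (\<tau> *\<^sub>R p)) \<le> real m * norm (Q p) + c0 * (\<tau> * norm p)"
proof -
  have "\<tau> *\<^sub>R p = (\<Sum>j=1..m. \<tau> *\<^sub>R P j (C j p) + \<tau> *\<^sub>R (C j p - P j (C j p)))"
    by (simp add: scaleR_right_distrib[symmetric] scaleR_sum_right[symmetric] C_sum)
  then have "norm (V k (\<tau> *\<^sub>R p)) \<le> (\<Sum>j=1..m. norm (V k (\<tau> *\<^sub>R P j (C j p) + \<tau> *\<^sub>R (C j p - P j (C j p)))))"
    by (simp only: V_lin(4) norm_sum)
  also have "\<dots> \<le> (\<Sum>j=1..m. norm (Q p) + a' j / sqrt (\<eta> j) * (\<tau> * norm p))"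
  proof (rule sum_mono)
    fix j assume j: "j \<in> {1..m}"
    have "norm (V k (C j p - P j (C j p))) \<le> norm (C j p) / sqrt (\<eta> j)" by (rule V_complement[OF j])
    also have "\<dots> \<le> a' j * norm p / sqrt (\<eta> j)"
      using eta(1)[OF j] by (intro divide_right_mono C(4) j) auto
    finally have "\<tau> * norm (V k (C j p - P j (C j p))) \<le> \<tau> * (a' j * norm p / sqrt (\<eta> j))"
      using tau by (intro mult_left_mono) auto
    then have "norm (V k (\<tau> *\<^sub>R (C j p - P j (C j p)))) \<le> a' j / sqrt (\<eta> j) * (\<tau> * norm p)"
      unfolding V_lin(3) norm_scaleR using tau by (simp add: algebra_simps)
    with V_P_C[OF j] show "norm (V k (\<tau> *\<^sub>R P j (C j p) + \<tau> *\<^sub>R (C j p - P j (C j p))))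
        \<le> norm (Q p) + a' j / sqrt (\<eta> j) * (\<tau> * norm p)"
      unfolding V_lin(1) by (rule norm_triangle_mono)
  qed
  also have "\<dots> = real m * norm (Q p) + c0 * (\<tau> * norm p)"
    unfolding sum.distrib c0_def sum_distrib_right by simp
  finally show ?thesis .
qed

text \<open>Here p = A R h. The three norm bounds are the three terms of the squared norm of (I +
  \<tau>^2 A) R h, whose cross term is the squared norm of Q p.\<close>

lemma R_split:
  obtains p where "h = R h + \<tau>\<^sup>2 *\<^sub>R p" "R h = Q (Q p)" "h - R h = \<tau>\<^sup>2 *\<^sub>R p"
    "norm (R h) \<le> norm h" "\<tau> * norm (Q p) \<le> norm h" "\<tau>\<^sup>2 * norm p \<le> norm h"
proof -
  define p where "p = (1 / \<tau>\<^sup>2) *\<^sub>R (h - R h)"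
  have p: "h - R h = \<tau>\<^sup>2 *\<^sub>R p" using tau by (simp add: p_def)
  then have h: "h = R h + \<tau>\<^sup>2 *\<^sub>R p" by (simp add: algebra_simps)
  have Rp: "R h = Q (Q p)"
    using R(2)[of h] tau unfolding p linear_scale[OF Q(1)] by simp
  have "(norm (R h + \<tau>\<^sup>2 *\<^sub>R p))\<^sup>2 = (norm (R h))\<^sup>2 + 2 * \<tau>\<^sup>2 * inner (R h) p + (\<tau>\<^sup>2)\<^sup>2 * (norm p)\<^sup>2"
    unfolding power2_norm_eq_inner
    by (simp add: inner_add_left inner_add_right inner_commute power2_eq_square algebra_simps)
  then have "(norm h)\<^sup>2 = (norm (R h))\<^sup>2 + 2 * \<tau>\<^sup>2 * inner (R h) p + (\<tau>\<^sup>2)\<^sup>2 * (norm p)\<^sup>2"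
    by (simp only: h[symmetric])
  also have "inner (R h) p = (norm (Q p))\<^sup>2" by (simp add: Rp Q(2) power2_norm_eq_inner)
  finally have e: "(norm h)\<^sup>2 = (norm (R h))\<^sup>2 + 2 * (\<tau> * norm (Q p))\<^sup>2 + (\<tau>\<^sup>2 * norm p)\<^sup>2"
    by (simp add: power_mult_distrib)
  have sq: "x \<le> norm h" if "x\<^sup>2 \<le> (norm h)\<^sup>2" for x using that by (rule power2_le_imp_le) simp
  have nn: "0 \<le> (norm (R h))\<^sup>2" "0 \<le> (\<tau> * norm (Q p))\<^sup>2" "0 \<le> (\<tau>\<^sup>2 * norm p)\<^sup>2"
    by simp_all
  show thesis
    by (rule that[OF h Rp p]; rule sq; use e nn in linarith)
qed

lemma R_Q: "R (Q h) = Q (R h)"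
proof -
  obtain p where p: "h = R h + \<tau>\<^sup>2 *\<^sub>R p" "R h = Q (Q p)" by (rule R_split)
  have "Q h = Q (Q (Q p)) + \<tau>\<^sup>2 *\<^sub>R Q p"
    by (subst p(1), subst p(2)) (simp add: linear_add[OF Q(1)] linear_scale[OF Q(1)])
  then show ?thesis using R(3)[of "Q p"] by (simp add: p(2))
qed

lemma R_sym: "inner (R x) y = inner x (R y)"
proof -
  obtain p where p: "x = R x + \<tau>\<^sup>2 *\<^sub>R p" "R x = Q (Q p)" by (rule R_split)
  obtain q where q: "y = R y + \<tau>\<^sup>2 *\<^sub>R q" "R y = Q (Q q)" by (rule R_split)
  have "inner (R x) y = inner (R x) (R y) + \<tau>\<^sup>2 * inner (R x) q"
    by (subst q(1)) (simp add: inner_add_right)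
  moreover have "inner x (R y) = inner (R x) (R y) + \<tau>\<^sup>2 * inner p (R y)"
    by (subst p(1)) (simp add: inner_add_left)
  moreover have "inner (R x) q = inner p (R y)" by (simp add: p(2) q(2) Q(2))
  ultimately show ?thesis by simp
qed

text \<open>\<open>V_tau\<close> leaves a term \<tau> times the full norm, which the weak norm
  cannot control in general. It can for R h: R h is A^(1/2) R applied to Q h, so
  \<open>R_split\<close> at \<open>Q h\<close> gives \<tau> \<open>norm (R h)\<close> <=
  \<open>norm (Q h)\<close>.\<close>

lemma V_R: "norm (V k (\<tau> *\<^sub>R R h)) \<le> c2 * norm (Q h)"
proof -
  obtain p where p: "R (Q h) = Q (Q p)" "norm (R (Q h)) \<le> norm (Q h)"
    "\<tau> * norm (Q p) \<le> norm (Q h)" "Q h - R (Q h) = \<tau>\<^sup>2 *\<^sub>R p" by (rule R_split)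
  obtain p' where p': "h - R h = \<tau>\<^sup>2 *\<^sub>R p'" "R h = Q (Q p')" by (rule R_split)
  have "\<tau>\<^sup>2 *\<^sub>R p = \<tau>\<^sup>2 *\<^sub>R Q p'"
    using p(4) arg_cong[OF p'(1), of Q] by (simp add: linear_diff[OF Q(1)] linear_scale[OF Q(1)] R_Q)
  then have "Q p = R h" using tau p'(2) by simp
  with p have b: "\<tau> * norm (R h) \<le> norm (Q h)" "norm (Q (R h)) \<le> norm (Q h)" by (simp_all add: R_Q)
  have "norm (V k (\<tau> *\<^sub>R R h)) \<le> real m * norm (Q (R h)) + c0 * (\<tau> * norm (R h))" by (rule V_tau)
  also have "\<dots> \<le> real m * norm (Q h) + c0 * norm (Q h)"
    using b c0_nonneg by (intro add_mono mult_left_mono) auto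
  finally show ?thesis by (simp add: c2_def algebra_simps)
qed

text \<open>h - R h = \<tau>^2 A R h has two powers of \<tau>: one enters \<open>V_tau\<close>, the
  other is used by the energy bounds of \<open>R_split\<close>.\<close>

lemma V_R_complement: "norm (V k (h - R h)) \<le> c2 * norm h"
proof -
  obtain p where p: "h - R h = \<tau>\<^sup>2 *\<^sub>R p" "\<tau> * norm (Q p) \<le> norm h" "\<tau>\<^sup>2 * norm p \<le> norm h"
    by (rule R_split)
  have "norm (V k (h - R h)) = \<tau> * norm (V k (\<tau> *\<^sub>R p))"
    unfolding p(1) V_lin norm_scaleR using tau by (simp add: power2_eq_square)
  also have "\<dots> \<le> \<tau> * (real m * norm (Q p) + c0 * (\<tau> * norm p))"
    using tau by (intro mult_left_mono V_tau) auto
  also have "\<dots> = real m * (\<tau> * norm (Q p)) + c0 * (\<tau>\<^sup>2 * norm p)"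
    by (simp add: power2_eq_square algebra_simps)
  also have "\<dots> \<le> real m * norm h + c0 * norm h"
    using p c0_nonneg by (intro add_mono mult_left_mono) auto
  finally show ?thesis by (simp add: c2_def algebra_simps)
qed

text \<open>The gap s = \<tau>^2 \<nu> in \<open>cheb_gap\<close>; after taking roots this is where
  \<nu>^(-1/2) arises.\<close>

lemma V_bound: "\<tau> * norm (V (Suc (Suc k)) x) \<le> norm x / sqrt \<nu>"
proof -
  have "\<tau>\<^sup>2 * \<nu> * (norm (V (Suc (Suc k)) x))\<^sup>2 \<le> (norm x)\<^sup>2"
    by (rule cheb_gap[OF L_gap]) (use nu in simp)
  then have "(sqrt \<nu> * (\<tau> * norm (V (Suc (Suc k)) x)))\<^sup>2 \<le> (norm x)\<^sup>2"
    using nu by (simp only: power_mult_distrib real_sqrt_pow2 less_imp_le) (simp add: algebra_simps)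
  then have "sqrt \<nu> * (\<tau> * norm (V (Suc (Suc k)) x)) \<le> norm x" by (rule power2_le_imp_le) simp
  then show ?thesis using nu by (simp del: cheb.simps add: field_simps)
qed

text \<open>The nonlinear term always comes with a resolvent, which rescues index 1, where
  \<open>V\<close> is the identity: there \<tau> sqrt \<nu> <= 1 + \<tau>^2 \<nu> is absorbed by
  \<open>P_norm\<close>.\<close>

lemma V_resolvent_bound:
  assumes j: "j \<in> {1..m}"
  shows "\<tau> * norm (V (Suc k) (P j x)) \<le> norm x / sqrt \<nu>"
proof (cases k)
  case 0
  have "0 \<le> (1 - \<tau> * sqrt \<nu>)\<^sup>2" by simp
  also have "\<dots> = (1 + \<tau>\<^sup>2 * \<nu>) - 2 * (\<tau> * sqrt \<nu>)"
    using nu by (simp add: power2_diff power_mult_distrib)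
  finally have "2 * (\<tau> * sqrt \<nu>) \<le> 1 + \<tau>\<^sup>2 * \<nu>" by simp
  moreover have "0 \<le> \<tau> * sqrt \<nu>" using tau nu by simp
  ultimately have "\<tau> * sqrt \<nu> \<le> 1 + \<tau>\<^sup>2 * \<nu>" by linarith
  then have "\<tau> * sqrt \<nu> * norm (P j x) \<le> (1 + \<tau>\<^sup>2 * \<nu>) * norm (P j x)"
    by (rule mult_right_mono) simp
  also have "\<dots> \<le> norm x" by (rule P_norm[OF j])
  finally show ?thesis using nu 0 by (simp add: field_simps)
next
  case (Suc i)
  have "\<tau> * norm (V (Suc (Suc i)) (P j x)) \<le> norm (P j x) / sqrt \<nu>" by (rule V_bound)
  also have "\<dots> \<le> norm x / sqrt \<nu>" using nu by (intro divide_right_mono P_contraction j) auto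
  finally show ?thesis by (simp only: Suc)
qed

section \<open>Consistency: the defect of the exact solution\<close>

lemma complement_L_Q: "Q (Q p) - L (Q (Q p)) = \<tau>\<^sup>2 *\<^sub>R (\<Sum>j=1..m. P j (C j p))"
  unfolding complement_L scaleR_sum_right by (intro sum.cong refl P(4))

lemma V_complement_L_Q: "norm (V k (Q (Q p) - L (Q (Q p)))) \<le> real m * \<tau> * norm (Q p)"
proof -
  have "norm (V k (Q (Q p) - L (Q (Q p)))) = norm (\<Sum>j=1..m. \<tau> *\<^sub>R V k (\<tau> *\<^sub>R P j (C j p)))"
    unfolding complement_L_Q by (simp add: V_lin scaleR_sum_right power2_eq_square)
  also have "\<dots> \<le> (\<Sum>j=1..m. \<tau> * norm (Q p))"
  proof (rule sum_norm_le)
    fix j assume j: "j \<in> {1..m}"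
    show "norm (\<tau> *\<^sub>R V k (\<tau> *\<^sub>R P j (C j p))) \<le> \<tau> * norm (Q p)"
      unfolding norm_scaleR using tau V_P_C[OF j, of k p] by simp
  qed
  finally show ?thesis by simp
qed

text \<open>R p is the sum of the \<open>C j (R p)\<close>, so the difference splits by j into (I -
  P_j) C_j R p and P_j C_j (p - R p). The first is of order \<tau>^2 by \<open>V_complement\<close>;
  in the second \<open>V_P_C\<close> uses one \<tau>, and \<tau> A^(-1/2) (I - R) is again of order
  \<tau>^2. Together they cost c0 + m.\<close>

lemma V_stationary_defect:
  "norm (V k (\<tau>\<^sup>2 *\<^sub>R R p - (Q (Q p) - L (Q (Q p))))) \<le> \<tau>\<^sup>2 * (c2 * norm p)"
proof -
  obtain q where q: "p - R p = \<tau>\<^sup>2 *\<^sub>R q" "\<tau> * norm (Q q) \<le> norm p" "norm (R p) \<le> norm p"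
    by (rule R_split)
  have "\<tau> * norm (Q (p - R p)) = \<tau>\<^sup>2 * (\<tau> * norm (Q q))"
    unfolding q(1) by (simp add: linear_scale[OF Q(1)])
  also have "\<dots> \<le> \<tau>\<^sup>2 * norm p" by (intro mult_left_mono q(2)) simp
  finally have Qd: "\<tau> * norm (Q (p - R p)) \<le> \<tau>\<^sup>2 * norm p" .
  let ?x = "\<lambda>j. C j (R p) - P j (C j (R p))" and ?y = "\<lambda>j. P j (C j (p - R p))"
  have "\<tau>\<^sup>2 *\<^sub>R R p - (Q (Q p) - L (Q (Q p))) = \<tau>\<^sup>2 *\<^sub>R (\<Sum>j=1..m. C j (R p) - P j (C j p))"
    unfolding complement_L_Q by (simp add: sum_subtractf C_sum scaleR_diff_right)
  also have "(\<Sum>j=1..m. C j (R p) - P j (C j p)) = (\<Sum>j=1..m. ?x j - ?y j)"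
    by (intro sum.cong refl) (simp add: linear_diff[OF C(1)] linear_diff[OF P(1)])
  finally have eq: "\<tau>\<^sup>2 *\<^sub>R R p - (Q (Q p) - L (Q (Q p))) = (\<Sum>j=1..m. \<tau>\<^sup>2 *\<^sub>R (?x j - ?y j))"
    by (simp add: scaleR_sum_right)
  have "norm (V k (\<Sum>j=1..m. \<tau>\<^sup>2 *\<^sub>R (?x j - ?y j))) \<le> (\<Sum>j=1..m. norm (V k (\<tau>\<^sup>2 *\<^sub>R (?x j - ?y j))))"
    by (simp only: V_lin(4) norm_sum)
  also have "\<dots> \<le> (\<Sum>j=1..m. \<tau>\<^sup>2 * (a' j / sqrt (\<eta> j) * norm p) + \<tau>\<^sup>2 * norm p)"
  proof (rule sum_mono)
    fix j assume j: "j \<in> {1..m}"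
    have e: "0 < \<eta> j" using eta(1)[OF j] by simp
    have "norm (V k (?x j)) \<le> norm (C j (R p)) / sqrt (\<eta> j)" by (rule V_complement[OF j])
    also have "\<dots> \<le> a' j * norm p / sqrt (\<eta> j)"
      using C(4)[OF j, of "R p"] mult_left_mono[OF q(3) C(5)[OF j]] e
      by (intro divide_right_mono) auto
    also have "\<dots> = a' j / sqrt (\<eta> j) * norm p" by simp
    finally have x: "norm (\<tau>\<^sup>2 *\<^sub>R V k (?x j)) \<le> \<tau>\<^sup>2 * (a' j / sqrt (\<eta> j) * norm p)"
      unfolding norm_scaleR by (simp del: times_divide_eq_left add: mult_left_mono)
    have "norm (\<tau>\<^sup>2 *\<^sub>R V k (?y j)) = \<tau> * norm (V k (\<tau> *\<^sub>R ?y j))"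
      using tau by (simp add: V_lin power2_eq_square)
    also have "\<dots> \<le> \<tau> * norm (Q (p - R p))" using tau by (intro mult_left_mono V_P_C j) auto
    finally have y: "norm (\<tau>\<^sup>2 *\<^sub>R V k (?y j)) \<le> \<tau>\<^sup>2 * norm p" using Qd by simp
    have "V k (\<tau>\<^sup>2 *\<^sub>R (?x j - ?y j)) = \<tau>\<^sup>2 *\<^sub>R V k (?x j) - \<tau>\<^sup>2 *\<^sub>R V k (?y j)"
      unfolding V_lin(3) V_lin(2)[of k "?x j" "?y j"] by (rule scaleR_diff_right)
    then show "norm (V k (\<tau>\<^sup>2 *\<^sub>R (?x j - ?y j))) \<le> \<tau>\<^sup>2 * (a' j / sqrt (\<eta> j) * norm p) + \<tau>\<^sup>2 * norm p"
      by (simp only: order_trans[OF norm_triangle_ineq4 add_mono[OF x y]])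
  qed
  also have "\<dots> = \<tau>\<^sup>2 * (c2 * norm p)"
    unfolding sum.distrib c2_def c0_def sum_distrib_left[symmetric] sum_distrib_right[symmetric]
    by (simp add: algebra_simps)
  finally show ?thesis unfolding eq .
qed

text \<open>Inserting the exact solution into the scheme leaves the defect estimated here. The second difference is
  split by \<open>R\<close>: on the range of \<open>R\<close> it is compared with \<open>\<tau>\<^sup>2 u''\<close> through \<^term>\<open>X\<close>, while
  \<open>(I - R) A\<^sup>-\<^sup>1 = \<tau>\<^sup>2 R\<close> takes care of the rest.\<close>

lemma V_defect:
  fixes pl p pr g :: 'a
  defines "D \<equiv> Q (Q pr) - 2 *\<^sub>R Q (Q p) + Q (Q pl)"
  assumes X: "norm (V k (R (D - \<tau>\<^sup>2 *\<^sub>R (g - p)))) \<le> X"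
  shows "norm (V k (L (2 *\<^sub>R Q (Q p) - Q (Q pl)) + \<tau>\<^sup>2 *\<^sub>R P 1 g - Q (Q pr)))
    \<le> \<tau>\<^sup>2 * (c2 * norm p + (1 / sqrt (\<eta> 1) + c2) * norm g)
      + \<tau> * ((real m + c2) * norm (Q p - Q pl) + c2 * norm (Q p - Q pr)) + X"
proof -
  define d where "d = pr - 2 *\<^sub>R p + pl"
  note linQ = linear_add[OF Q(1)] linear_diff[OF Q(1)] linear_scale[OF Q(1)]
  note linR = linear_add[OF R(1)] linear_diff[OF R(1)] linear_scale[OF R(1)]
  note linL = linear_add[OF linear_L] linear_diff[OF linear_L] linear_scale[OF linear_L]
  have D: "D = Q (Q d)" by (simp add: D_def d_def linQ)
  have RD: "D = R D + \<tau>\<^sup>2 *\<^sub>R R d" using R(3)[of d] by (simp add: D linR)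
  \<comment> \<open>T1 is the backward increment under I - L, T2 the stationary mismatch, T3 the
    part of the second difference off the range of R, T4 the exchange of R for \<open>P 1\<close> at
    the source, T5 the Taylor remainder. The increments in T1 and T3 give the coefficient m +
    c2.\<close>
  let ?T1 = "Q (Q (p - pl)) - L (Q (Q (p - pl)))"
  let ?T2 = "\<tau>\<^sup>2 *\<^sub>R R p - (Q (Q p) - L (Q (Q p)))"
  let ?T3 = "\<tau>\<^sup>2 *\<^sub>R R d"
  let ?T4 = "\<tau>\<^sup>2 *\<^sub>R ((g - R g) - (g - P 1 g))"
  let ?T5 = "R (D - \<tau>\<^sup>2 *\<^sub>R (g - p))"
  have "L (2 *\<^sub>R Q (Q p) - Q (Q pl)) + \<tau>\<^sup>2 *\<^sub>R P 1 g - Q (Q pr)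
      = - ?T1 - (Q (Q p) - L (Q (Q p))) - D + \<tau>\<^sup>2 *\<^sub>R P 1 g"
    by (simp add: D_def linQ linL scaleR_2 algebra_simps)
  also have "\<dots> = - ?T1 - (Q (Q p) - L (Q (Q p))) - (R D + \<tau>\<^sup>2 *\<^sub>R R d) + \<tau>\<^sup>2 *\<^sub>R P 1 g"
    by (simp only: RD[symmetric])
  also have "\<dots> = - ?T1 + ?T2 - ?T3 + ?T4 - ?T5"
    by (simp add: linR algebra_simps)
  finally have eq: "L (2 *\<^sub>R Q (Q p) - Q (Q pl)) + \<tau>\<^sup>2 *\<^sub>R P 1 g - Q (Q pr)
      = - ?T1 + ?T2 - ?T3 + ?T4 - ?T5" .
  have T1: "norm (V k ?T1) \<le> real m * \<tau> * norm (Q p - Q pl)"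
    using V_complement_L_Q[of k "p - pl"] by (simp add: linQ)
  have T2: "norm (V k ?T2) \<le> \<tau>\<^sup>2 * (c2 * norm p)" by (rule V_stationary_defect)
  have c2: "0 \<le> c2" using c0_nonneg by (simp add: c2_def)
  have "norm (V k ?T3) = \<tau> * norm (V k (\<tau> *\<^sub>R R d))"
    using tau by (simp add: V_lin power2_eq_square)
  also have "\<dots> \<le> \<tau> * (c2 * norm (Q d))" using tau by (intro mult_left_mono V_R) auto
  also have "\<dots> \<le> \<tau> * (c2 * (norm (Q p - Q pl) + norm (Q p - Q pr)))"
  proof (intro mult_left_mono)
    have "Q d = - ((Q p - Q pl) + (Q p - Q pr))"
      by (simp add: d_def linQ scaleR_2)
    then show "norm (Q d) \<le> norm (Q p - Q pl) + norm (Q p - Q pr)"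
      by (simp only: norm_minus_cancel norm_triangle_ineq)
  qed (use tau c2 in auto)
  finally have T3: "norm (V k ?T3) \<le> \<tau> * (c2 * (norm (Q p - Q pl) + norm (Q p - Q pr)))" .
  have "norm (V k ?T4) = \<tau>\<^sup>2 * norm (V k (g - R g) - V k (g - P 1 g))" by (simp only: V_lin norm_scaleR) simp
  also have "\<dots> \<le> \<tau>\<^sup>2 * (c2 * norm g + norm g / sqrt (\<eta> 1))"
    by (intro mult_left_mono order_trans[OF norm_triangle_ineq4] add_mono V_R_complement V_complement m_pos) simp
  finally have T4: "norm (V k ?T4) \<le> \<tau>\<^sup>2 * (c2 * norm g + norm g / sqrt (\<eta> 1))" .
  have tri: "norm (- t1 + t2 - t3 + t4 - t5) \<le> norm t1 + norm t2 + norm t3 + norm t4 + norm t5"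
    for t1 t2 t3 t4 t5 :: 'a
    by (intro order_trans[OF norm_triangle_ineq4] order_trans[OF norm_triangle_ineq] add_mono order_refl) simp
  have "norm (V k (- ?T1 + ?T2 - ?T3 + ?T4 - ?T5))
      \<le> norm (V k ?T1) + norm (V k ?T2) + norm (V k ?T3) + norm (V k ?T4) + norm (V k ?T5)"
    by (simp only: V_lin(1)[of k "- ?T1"] V_lin(1)[of k "- ?T1 + ?T2 - ?T3"] V_lin(2)[of k _ ?T3]
        V_lin(2)[of k _ ?T5] linear_neg[OF linear_V] tri)
  then show ?thesis unfolding eq using T1 T2 T3 T4 X by (simp add: algebra_simps)
qed


text \<open>The kernel of the Taylor remainder is at most \<tau>; this \<tau> joins R, and
  \<open>V_R\<close> passes to the weak norm of the increment of u''.\<close>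

lemma V_R_second_difference:
  fixes u u' u'' :: "real \<Rightarrow> 'a"
  assumes u: "\<And>s. s \<in> {b - \<tau>..b + \<tau>} \<Longrightarrow> (u has_vector_derivative u' s) (at s within {b - \<tau>..b + \<tau>})"
    and u': "\<And>s. s \<in> {b - \<tau>..b + \<tau>} \<Longrightarrow> (u' has_vector_derivative u'' s) (at s within {b - \<tau>..b + \<tau>})"
    and N: "N integrable_on {b - \<tau>..b + \<tau>}"
    and bound: "\<And>s. s \<in> {b - \<tau>..b + \<tau>} \<Longrightarrow> c2 * norm (Q (u'' s - u'' b)) \<le> N s"
  shows "norm (V k (R (u (b + \<tau>) - 2 *\<^sub>R u b + u (b - \<tau>) - \<tau>\<^sup>2 *\<^sub>R u'' b)))
    \<le> integral {b - \<tau>..b + \<tau>} N"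
proof (rule norm_le_weak_integral[where T = "\<lambda>x. V k (R x)" and T' = "\<lambda>x. R (V k x)"
      and g = "\<lambda>s. (\<tau> - \<bar>s - b\<bar>) *\<^sub>R (u'' s - u'' b)"])
  fix \<phi>
  \<comment> \<open>Subtracting the quadratic with second derivative u''(b) turns u'' into its
    increment; the second difference of that quadratic is exactly \<tau>^2 u''(b).\<close>
  let ?h = "\<lambda>s. inner (u s) \<phi> - inner (u'' b) \<phi> * (s - b)\<^sup>2 / 2"
  let ?h' = "\<lambda>s. inner (u' s) \<phi> - inner (u'' b) \<phi> * (s - b)"
  let ?h'' = "\<lambda>s. inner (u'' s) \<phi> - inner (u'' b) \<phi>"
  have "((\<lambda>s. (\<tau> - \<bar>s - b\<bar>) * ?h'' s) has_integral ?h (b + \<tau>) - 2 * ?h b + ?h (b - \<tau>)) {b - \<tau>..b + \<tau>}"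
  proof (rule second_difference_has_integral[OF tau, where h' = ?h'])
    fix s assume s: "s \<in> {b - \<tau>..b + \<tau>}"
    have i: "((\<lambda>s. inner (w s) \<phi>) has_real_derivative inner w' \<phi>) (at s within {b - \<tau>..b + \<tau>})"
      if "(w has_vector_derivative w') (at s within {b - \<tau>..b + \<tau>})" for w w'
      using bounded_linear.has_vector_derivative[OF bounded_linear_inner_left that]
      by (simp add: has_real_derivative_iff_has_vector_derivative)
    show "(?h has_vector_derivative ?h' s) (at s within {b - \<tau>..b + \<tau>})"
      unfolding has_real_derivative_iff_has_vector_derivative[symmetric]
      by (rule derivative_eq_intros i u s refl | simp)+
    show "(?h' has_vector_derivative ?h'' s) (at s within {b - \<tau>..b + \<tau>})"
      unfolding has_real_derivative_iff_has_vector_derivative[symmetric]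
      by (rule derivative_eq_intros i u' s refl | simp)+
  qed
  then show "((\<lambda>s. inner ((\<tau> - \<bar>s - b\<bar>) *\<^sub>R (u'' s - u'' b)) \<phi>) has_integral
      inner (u (b + \<tau>) - 2 *\<^sub>R u b + u (b - \<tau>) - \<tau>\<^sup>2 *\<^sub>R u'' b) \<phi>) {b - \<tau>..b + \<tau>}"
    by (simp add: inner_diff_left inner_add_left algebra_simps)
next
  show "inner (V k (R x)) y = inner x (R (V k y))" for x y by (simp add: cheb_sym R_sym)
next
  fix s assume s: "s \<in> {b - \<tau>..b + \<tau>}"
  let ?x = "u'' s - u'' b"
  have "norm (V k (R ((\<tau> - \<bar>s - b\<bar>) *\<^sub>R ?x))) = (\<tau> - \<bar>s - b\<bar>) * norm (V k (R ?x))"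
    using s by (simp only: linear_scale[OF R(1)] V_lin(3) norm_scaleR) auto
  also have "\<dots> \<le> \<tau> * norm (V k (R ?x))" by (intro mult_right_mono) auto
  also have "\<dots> = norm (V k (\<tau> *\<^sub>R R ?x))" using tau by (simp add: V_lin(3))
  also have "\<dots> \<le> c2 * norm (Q ?x)" by (rule V_R)
  also have "\<dots> \<le> N s" by (rule bound[OF s])
  finally show "norm (V k (R ((\<tau> - \<bar>s - b\<bar>) *\<^sub>R ?x))) \<le> N s" .
qed (rule N)

end

section \<open>The error estimate\<close>

text \<open>A_j A^(-1) is everywhere defined because A^(-1) maps into the domain of A, which lies in
  that of A_j. The facts about \<open>P j\<close> are those about A_j read on the range of its
  resolvent.\<close>

lemma splitting_resolvents_exist:
  fixes A :: "'a::{real_inner, complete_space} unbounded_op" and A' :: "nat \<Rightarrow> 'a unbounded_op"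
  assumes A: "selfadjoint_op A" "\<alpha> > 0" "op_ge A \<alpha>"
    and A': "\<And>j. j \<in> {1..m} \<Longrightarrow> selfadjoint_op (A' j) \<and> \<alpha>' j > 0 \<and> op_ge (A' j) (\<alpha>' j)"
    and split: "A = op_sum {1..m} A'"
    and \<eta>: "\<And>j. j \<in> {1..m} \<Longrightarrow> 0 < \<eta> j \<and> \<eta> j < 1" "(\<Sum>j=1..m. \<eta> j) = 1"
    and \<tau>: "\<tau> > 0" and \<nu>: "\<nu> > 0" "\<And>j. j \<in> {1..m} \<Longrightarrow> \<nu> \<le> \<alpha>' j"
  obtains Q R P where
    "splitting_resolvents m \<eta> (\<lambda>j. onorm (\<lambda>x. A' j \<cdot> (A\<inverse> \<cdot> x))) \<tau> \<nu> Q R (\<lambda>j x. A' j \<cdot> (A\<inverse> \<cdot> x)) P"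
    "\<And>j. j \<in> {1..m} \<Longrightarrow> bounded_linear (\<lambda>x. A' j \<cdot> (A\<inverse> \<cdot> x))"
    "bounded_linear Q"
    "\<And>x y. (x, y) \<in> A \<Longrightarrow> Q (Q y) = x"
    "\<And>x. (op_sqrt A)\<inverse> \<cdot> x = Q x" "\<And>x. op_sqrt A \<cdot> Q x = x"
    "\<And>j x y. j \<in> {1..m} \<Longrightarrow> (x, y) \<in> A' j \<Longrightarrow> P j (x + (\<tau>\<^sup>2 / \<eta> j) *\<^sub>R y) = x"
proof -
  obtain Q where Q: "linear Q" "\<And>x y. inner (Q x) y = inner x (Q y)" "\<And>x. (Q (Q x), x) \<in> A"
    "\<And>x y. (x, y) \<in> A \<Longrightarrow> Q (Q y) = x" "\<And>x. (op_sqrt A)\<inverse> \<cdot> x = Q x" "\<And>x. op_sqrt A \<cdot> Q x = x"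
    using op_sqrt_inverse[OF A(1,3,2)] by blast
  note sv = selfadjoint_opD(2)
  have Ainv: "A\<inverse> \<cdot> x = Q (Q x)" for x
    by (rule op_apply_eq) (auto simp: single_valued_def Q(3) dest!: Q(4))
  define C where "C j x = A' j \<cdot> (Q (Q x))" for j x
  have Csum: "Q (Q x) \<in> (\<Inter>j\<in>{1..m}. Domain (A' j)) \<and> x = (\<Sum>j=1..m. C j x)" for x
    using Q(3)[of x] unfolding split op_sum_def C_def by blast
  have CA: "(Q (Q x), C j x) \<in> A' j" if j: "j \<in> {1..m}" for j x
    unfolding C_def by (rule op_apply_mem) (use Csum[of x] A'[OF j] j sv in blast)+
  have Clin: "linear (C j)" if j: "j \<in> {1..m}" for j
  proof (rule linearI)
    note subj = selfadjoint_opD(1)[of "A' j"] and svj = sv[of "A' j"]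
    note addQ = linear_add[OF Q(1), symmetric]
    fix x y
    have "(Q (Q x), C j x) + (Q (Q y), C j y) \<in> A' j"
      using CA[OF j] A'[OF j] by (intro subspace_add subj) auto
    then have "(Q (Q (x + y)), C j x + C j y) \<in> A' j" by (simp add: addQ)
    then show "C j (x + y) = C j x + C j y"
      using A'[OF j] unfolding C_def[of j "x + y"] by (intro op_apply_eq svj) auto
  next
    note subj = selfadjoint_opD(1)[of "A' j"] and svj = sv[of "A' j"]
    note scQ = linear_scale[OF Q(1), symmetric]
    fix r x
    have "r *\<^sub>R (Q (Q x), C j x) \<in> A' j"
      using CA[OF j] A'[OF j] by (intro subspace_scale subj) auto
    then have "(Q (Q (r *\<^sub>R x)), r *\<^sub>R C j x) \<in> A' j" by (simp add: scQ)
    then show "C j (r *\<^sub>R x) = r *\<^sub>R C j x"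
      using A'[OF j] unfolding C_def[of j "r *\<^sub>R x"] by (intro op_apply_eq svj) auto
  qed
  have Cbl: "bounded_linear (C j)" if j: "j \<in> {1..m}" for j
  proof (rule linear_bounded_if_weakly_bounded[OF Clin[OF j]])
    show "closure (Domain (A' j)) = UNIV" using A'[OF j] selfadjoint_opD(3) by blast
    fix y assume "y \<in> Domain (A' j)"
    then obtain w where w: "(y, w) \<in> A' j" by blast
    \<comment> \<open>Weak continuity on the domain of A_j: both A_j and A^(-1) are moved onto
      \<open>y\<close>.\<close>
    have "inner (C j x) y = inner x (Q (Q w))" for x
      using selfadjoint_op_inner[OF _ CA[OF j] w, of x] A'[OF j] by (simp add: Q(2))
    then show "continuous_on UNIV (\<lambda>x. inner (C j x) y)"
      by (simp add: continuous_intros)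
  qed
  have Qbl: "bounded_linear Q"
    by (rule linear_bounded_if_weakly_bounded[OF Q(1), where D = UNIV])
      (auto simp: Q(2) intro!: continuous_intros)
  have "\<exists>Pj. linear Pj \<and> (\<forall>h. (Pj h, (h - 1 *\<^sub>R Pj h) /\<^sub>R (\<tau>\<^sup>2 / \<eta> j)) \<in> A' j)
      \<and> (\<forall>x y. (x, y) \<in> A' j \<longrightarrow> Pj (1 *\<^sub>R x + (\<tau>\<^sup>2 / \<eta> j) *\<^sub>R y) = x)" if j: "j \<in> {1..m}" for j
  proof (rule selfadjoint_op_resolvent[of "A' j" "\<alpha>' j" "\<tau>\<^sup>2 / \<eta> j" 1])
    show k: "0 < \<tau>\<^sup>2 / \<eta> j" using \<tau> \<eta>(1)[OF j] by simp
    have "0 < (\<tau>\<^sup>2 / \<eta> j) * \<alpha>' j" using A'[OF j] by (intro mult_pos_pos k) auto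
    then show "0 < 1 + \<tau>\<^sup>2 / \<eta> j * \<alpha>' j" by linarith
  qed (use A'[OF j] in blast)+
  then have "\<forall>j. \<exists>Pj. j \<in> {1..m} \<longrightarrow> linear Pj \<and> (\<forall>h. (Pj h, (h - 1 *\<^sub>R Pj h) /\<^sub>R (\<tau>\<^sup>2 / \<eta> j)) \<in> A' j)
      \<and> (\<forall>x y. (x, y) \<in> A' j \<longrightarrow> Pj (1 *\<^sub>R x + (\<tau>\<^sup>2 / \<eta> j) *\<^sub>R y) = x)" by blast
  then obtain P where P': "\<forall>j. j \<in> {1..m} \<longrightarrow> linear (P j) \<and> (\<forall>h. (P j h, (h - 1 *\<^sub>R P j h) /\<^sub>R (\<tau>\<^sup>2 / \<eta> j)) \<in> A' j)
      \<and> (\<forall>x y. (x, y) \<in> A' j \<longrightarrow> P j (1 *\<^sub>R x + (\<tau>\<^sup>2 / \<eta> j) *\<^sub>R y) = x)"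
    by (rule choice[THEN exE])
  have P: "linear (P j)" "(P j h, (\<eta> j / \<tau>\<^sup>2) *\<^sub>R (h - P j h)) \<in> A' j"
    "(x, y) \<in> A' j \<Longrightarrow> P j (x + (\<tau>\<^sup>2 / \<eta> j) *\<^sub>R y) = x" if "j \<in> {1..m}" for j h x y
    using P' that by (simp_all add: divide_simps)
  obtain R where R: "linear R" "\<And>h. (R h, (h - 1 *\<^sub>R R h) /\<^sub>R \<tau>\<^sup>2) \<in> A"
    "\<And>x y. (x, y) \<in> A \<Longrightarrow> R (1 *\<^sub>R x + \<tau>\<^sup>2 *\<^sub>R y) = x"
  proof (rule selfadjoint_op_resolvent[OF A(1,3), of "\<tau>\<^sup>2" 1])
    have "0 < \<tau>\<^sup>2 * \<alpha>" using \<tau> A(2) by simp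
    then show "0 < 1 + \<tau>\<^sup>2 * \<alpha>" by linarith
  qed (use \<tau> in auto)
  have "splitting_resolvents m \<eta> (\<lambda>j. onorm (C j)) \<tau> \<nu> Q R C P"
  proof (rule splitting_resolvents.intro)
    fix j assume j: "j \<in> {1..m}"
    note Aj = A'[OF j] and e = \<eta>(1)[OF j]
    show "0 < \<eta> j \<and> \<eta> j < 1" by (rule e)
    show "linear (C j)" by (rule Clin[OF j])
    show "0 \<le> onorm (C j)" by (rule onorm_pos_le[OF Cbl[OF j]])
    show "linear (P j)" by (rule P(1)[OF j])
    fix p x y
    show "norm (C j p) \<le> onorm (C j) * norm p" by (rule onorm[OF Cbl[OF j]])
    have "\<alpha>' j * (norm (Q (Q p)))\<^sup>2 \<le> inner (C j p) (Q (Q p))"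
      using Aj sv by (intro op_geD[OF _ _ CA[OF j]]) auto
    then show "0 \<le> inner (C j p) (Q (Q p))" using Aj by (meson less_imp_le mult_nonneg_nonneg order_trans zero_le_power2)
    have "inner ((\<eta> j / \<tau>\<^sup>2) *\<^sub>R (x - P j x)) (P j y) = inner (P j x) ((\<eta> j / \<tau>\<^sup>2) *\<^sub>R (y - P j y))"
      using Aj by (intro selfadjoint_op_inner[OF _ P(2)[OF j] P(2)[OF j]]) auto
    then show "inner (P j x) y = inner x (P j y)"
      using \<tau> e by (simp add: inner_diff_left inner_diff_right)
    have "\<nu> * (norm (P j x))\<^sup>2 \<le> \<alpha>' j * (norm (P j x))\<^sup>2" by (intro mult_right_mono \<nu>(2) j) simp
    also have "\<dots> \<le> inner ((\<eta> j / \<tau>\<^sup>2) *\<^sub>R (x - P j x)) (P j x)"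
      using Aj sv by (intro op_geD[OF _ _ P(2)[OF j]]) auto
    finally have "\<tau>\<^sup>2 * (\<nu> * (norm (P j x))\<^sup>2) \<le> \<tau>\<^sup>2 * inner ((\<eta> j / \<tau>\<^sup>2) *\<^sub>R (x - P j x)) (P j x)"
      by (rule mult_left_mono) simp
    then show "\<tau>\<^sup>2 * \<nu> * (norm (P j x))\<^sup>2 \<le> \<eta> j * inner (P j x) (x - P j x)"
      using \<tau> by (simp add: inner_commute mult.assoc)
    have "P j (Q (Q p)) + (\<tau>\<^sup>2 / \<eta> j) *\<^sub>R P j (C j p) = Q (Q p)"
      using P(3)[OF j CA[OF j]] by (simp add: linear_add[OF P(1)[OF j]] linear_scale[OF P(1)[OF j]])
    then have "Q (Q p) - P j (Q (Q p)) = (\<tau>\<^sup>2 / \<eta> j) *\<^sub>R P j (C j p)" by (simp add: algebra_simps)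
    then show "\<eta> j *\<^sub>R (Q (Q p) - P j (Q (Q p))) = \<tau>\<^sup>2 *\<^sub>R P j (C j p)" using e by simp
  next
    fix h p
    show "(\<Sum>j=1..m. C j p) = p" using Csum[of p] by simp
    have "Q (Q ((h - R h) /\<^sub>R \<tau>\<^sup>2)) = R h" using Q(4)[OF R(2)[of h]] by simp
    then have "\<tau>\<^sup>2 *\<^sub>R R h = \<tau>\<^sup>2 *\<^sub>R Q (Q ((h - R h) /\<^sub>R \<tau>\<^sup>2))" by simp
    then show "\<tau>\<^sup>2 *\<^sub>R R h = Q (Q (h - R h))" using \<tau> by (simp only: linear_scale[OF Q(1)]) simp
    show "R (Q (Q p) + \<tau>\<^sup>2 *\<^sub>R p) = Q (Q p)" using R(3)[OF Q(3)] by simp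
  qed (use \<eta> \<tau> \<nu> Q R in auto)
  moreover have "(\<lambda>x. A' j \<cdot> (A\<inverse> \<cdot> x)) = C j" for j unfolding Ainv C_def ..
  ultimately show thesis using that[of Q R P] Cbl Qbl Q P(3) by simp
qed

lemma powr_minus_half: "0 < x \<Longrightarrow> x powr (-1/2) = 1 / sqrt x" for x :: real
  using powr_minus_divide[of x "1/2"] by (simp add: powr_half_sqrt)

text \<open>The lower bound \<open>1 / x \<ge> 4 - 4 * x\<close> is the tangent at \<open>x = 1/2\<close>; summed over the weights it gives
  \<open>4 * m - 4\<close>, and \<open>m \<ge> 2\<close> because every weight is below \<open>1\<close>.\<close>

lemma weight_constants:
  fixes \<eta> a' :: "nat \<Rightarrow> real"
  assumes \<eta>: "\<And>j. j \<in> {1..m} \<Longrightarrow> 0 < \<eta> j \<and> \<eta> j < 1" "(\<Sum>j=1..m. \<eta> j) = 1"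
    and a': "\<And>j. j \<in> {1..m} \<Longrightarrow> 0 \<le> a' j"
  shows "2 * real m + (\<Sum>j=1..m. a' j / sqrt (\<eta> j)) \<le> (\<Sum>j=1..m. \<eta> j powr (-3/2) * (a' j / \<eta> j + 1))"
proof -
  have "m \<noteq> 0" using \<eta>(2) by (cases m) auto
  moreover have "m \<noteq> 1" using \<eta> by force
  ultimately have m: "2 \<le> m" by linarith
  have "2 * real m \<le> (\<Sum>j=1..m. 4 - 4 * \<eta> j)"
    using m by (simp only: sum_subtractf sum_distrib_left[symmetric] \<eta>(2)) simp
  then have "2 * real m + (\<Sum>j=1..m. a' j / sqrt (\<eta> j)) \<le> (\<Sum>j=1..m. (4 - 4 * \<eta> j) + a' j / sqrt (\<eta> j))"
    by (simp only: sum.distrib add_mono order_refl)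
  also have "\<dots> \<le> (\<Sum>j=1..m. \<eta> j powr (-3/2) * (a' j / \<eta> j + 1))"
  proof (rule sum_mono)
    fix j assume j: "j \<in> {1..m}"
    note e = \<eta>(1)[OF j]
    have "0 \<le> (2 * \<eta> j - 1)\<^sup>2" by simp
    then have "4 - 4 * \<eta> j \<le> 1 / \<eta> j" using e by (simp add: field_simps power2_eq_square)
    also have "\<dots> = \<eta> j powr (-1)" using e by (simp add: powr_minus_divide)
    also have "\<dots> \<le> \<eta> j powr (-3/2)" using e by (intro powr_mono') auto
    finally have 1: "4 - 4 * \<eta> j \<le> \<eta> j powr (-3/2)" .
    have "1 / sqrt (\<eta> j) \<le> \<eta> j powr (-3/2)"
      using e by (subst powr_minus_half[symmetric]) (auto intro: powr_mono')
    then have "1 / sqrt (\<eta> j) * a' j \<le> \<eta> j powr (-3/2) * (a' j / \<eta> j)"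
    proof (rule mult_mono)
      have "a' j * \<eta> j \<le> a' j" using e a'[OF j] by (simp add: mult_left_le)
      then show "a' j \<le> a' j / \<eta> j" using e by (simp add: field_simps)
    qed (use a'[OF j] in auto)
    with 1 show "4 - 4 * \<eta> j + a' j / sqrt (\<eta> j) \<le> \<eta> j powr (-3/2) * (a' j / \<eta> j + 1)"
      by (simp add: distrib_left)
  qed
  finally show ?thesis .
qed

theorem theorem3p1:
  fixes A :: "'a::{real_inner, complete_space} unbounded_op"
    and A' :: "nat \<Rightarrow> 'a unbounded_op"
    and M :: "'a \<Rightarrow> 'a"
    and f u :: "real \<Rightarrow> 'a"
    and v z :: "nat \<Rightarrow> 'a"
    and \<phi>0 \<phi>1 :: 'a
    and \<alpha> a T \<tau> \<nu> c \<gamma>0 \<gamma>1 c0 c1 c2 c3 :: real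
    and \<alpha>' \<eta> a' t \<Theta> :: "nat \<Rightarrow> real"
    and m n :: nat
    and ft w1 w2 :: "real \<Rightarrow> 'a"
    and J :: "nat \<Rightarrow> real \<Rightarrow> (real \<Rightarrow> 'a) \<Rightarrow> real"
  assumes A: "selfadjoint_op A" "\<alpha> > 0" "op_ge A \<alpha>"
    and A': "\<And>j. j \<in> {1..m} \<Longrightarrow> selfadjoint_op (A' j) \<and> \<alpha>' j > 0 \<and> op_ge (A' j) (\<alpha>' j)"
    and split: "A = op_sum {1..m} A'"
    and M: "a > 0" "\<And>x y. norm (M x - M y) \<le> a * norm (x - y)"
    and T: "T > 0" and f: "continuous_on {0..T} f"
    and \<eta>: "\<And>j. j \<in> {1..m} \<Longrightarrow> 0 < \<eta> j \<and> \<eta> j < 1" "(\<Sum>j=1..m. \<eta> j) = 1"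
    and n: "n > 1"
    and \<tau>: "\<tau> = T / real n"
    and t: "\<And>k. t k = real k * \<tau>"
    and scheme: "splitting_scheme m A' \<eta> M f \<tau> n \<phi>0 \<phi>1 v"
    and sol: "cauchy_solution A M f T \<phi>0 \<phi>1 u"
    and z: "\<And>k. z k = v k - u (t k)"
    and \<nu>: "\<nu> = Min (\<alpha>' ` {1..m})"
    and c: "c = \<nu> powr (-1/2) * a"
    and \<gamma>0: "\<gamma>0 = \<nu> powr (-1/2) + c * \<tau>\<^sup>2"
    and \<gamma>1: "\<gamma>1 = 1 + c * \<tau>"
    and a': "\<And>j. a' j = onorm (\<lambda>x. A' j \<cdot> (A\<inverse> \<cdot> x))"
    and c0: "c0 = (\<Sum>j=1..m. \<eta> j powr (-1/2) * a' j)"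
    and c1: "c1 = (\<Sum>j=1..m. \<eta> j powr (-3/2) * (a' j / \<eta> j + 1))"
    and c2: "c2 = real m + c0"
    and c3: "c3 = \<eta> 1 powr (-1/2) + real m + c0"
    and ft: "\<And>s. ft s = f s - M (u s)"
    and w1: "\<And>s. w1 s = op_sqrt A \<cdot> u s"
    and w2: "\<And>s. w2 s = (op_sqrt A)\<inverse> \<cdot> ft s"
    and J: "\<And>i s w. J i s w = norm (w (t i) - w s)"
    and \<Theta>: "\<And>k. \<Theta> k =
        \<tau>\<^sup>2 * (\<Sum>i=1..k. c1 * norm (A \<cdot> u (t i)) + c3 * norm (ft (t i)))
      + \<tau> * (\<Sum>i=1..k. c1 * J i (t (i - 1)) w1 + c2 * J i (t (i + 1)) w1)
      + c2 * (\<Sum>i=1..k. integral {t (i - 1)..t (i + 1)} (\<lambda>s. J i s w1 + J i s w2))"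
  shows "(\<forall>j\<in>{1..m}. bounded_linear (\<lambda>x. A' j \<cdot> (A\<inverse> \<cdot> x))) \<and>
    (\<forall>k\<in>{1..n - 1}.
      norm (z (k + 1)) \<le> exp (c * t (k - 1)) *
        (\<gamma>0 * norm ((z 1 - z 0) /\<^sub>R \<tau>) + \<gamma>1 * norm (z 0) + \<Theta> k))"
proof -
  have m1: "1 \<in> {1..m}" using \<eta>(2) by (cases m) auto
  have \<nu>0: "\<nu> > 0" unfolding \<nu> using A' m1 by (subst Min_gr_iff) auto
  have \<nu>le: "\<nu> \<le> \<alpha>' j" if "j \<in> {1..m}" for j unfolding \<nu> using that by (intro Min_le) auto
  have \<tau>0: "\<tau> > 0" using T n by (simp add: \<tau>)
  have t0: "t (Suc k) = t k + \<tau>" for k by (simp add: t algebra_simps)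
  have t_in: "t k \<in> {0..T}" if "k \<le> n" for k
  proof -
    have "real k * T \<le> real n * T" using that T by (intro mult_right_mono) auto
    then show ?thesis using n T by (simp add: t \<tau> field_simps)
  qed
  obtain Q R P where loc: "splitting_resolvents m \<eta> (\<lambda>j. onorm (\<lambda>x. A' j \<cdot> (A\<inverse> \<cdot> x))) \<tau> \<nu> Q R
      (\<lambda>j x. A' j \<cdot> (A\<inverse> \<cdot> x)) P"
    and bl: "\<And>j. j \<in> {1..m} \<Longrightarrow> bounded_linear (\<lambda>x. A' j \<cdot> (A\<inverse> \<cdot> x))"
    and Q: "bounded_linear Q" "\<And>x y. (x, y) \<in> A \<Longrightarrow> Q (Q y) = x"
      "\<And>x. (op_sqrt A)\<inverse> \<cdot> x = Q x" "\<And>x. op_sqrt A \<cdot> Q x = x"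
    and PA: "\<And>j x y. j \<in> {1..m} \<Longrightarrow> (x, y) \<in> A' j \<Longrightarrow> P j (x + (\<tau>\<^sup>2 / \<eta> j) *\<^sub>R y) = x"
    by (rule splitting_resolvents_exist[OF A A' split \<eta> \<tau>0 \<nu>0 \<nu>le]) blast+
  interpret S: splitting_resolvents m \<eta> a' \<tau> \<nu> Q R "\<lambda>j x. A' j \<cdot> (A\<inverse> \<cdot> x)" P
    using loc by (simp only: a'[symmetric])
  note e1 = \<eta>(1)[OF m1]
  have c0_eq: "S.c0 = c0"
    unfolding c0 S.c0_def using \<eta>(1) by (intro sum.cong refl) (simp only: powr_minus_half, simp)
  have c2_eq: "S.c2 = c2" unfolding c2 S.c2_def c0_eq ..
  have c3_eq: "c3 = 1 / sqrt (\<eta> 1) + c2" using powr_minus_half[of "\<eta> 1"] e1 unfolding c3 c2 by simp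
  have c2_nn: "0 \<le> c2" using S.c0_nonneg unfolding c2 c0_eq by simp
  have c1_ge: "real m + c2 \<le> c1"
    using weight_constants[of m \<eta> a', OF \<eta> S.C(5)] c0_eq unfolding c1 c2 S.c0_def by simp
  then have c12: "c2 \<le> c1" by simp
  have c1_nn: "0 \<le> c1" and c3_nn: "0 \<le> c3" using c12 c2_nn e1 by (auto simp: c3_eq)
  have c_eq: "c = a / sqrt \<nu>" using powr_minus_half[OF \<nu>0] unfolding c by simp
  have c_nn: "0 \<le> c" using M(1) \<nu>0 by (simp add: c_eq)

  obtain u' u'' where u: "\<And>s. s \<in> {0..T} \<Longrightarrow> (u has_vector_derivative u' s) (at s within {0..T})"
      "\<And>s. s \<in> {0..T} \<Longrightarrow> (u' has_vector_derivative u'' s) (at s within {0..T})"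
    and uA: "\<And>s. s \<in> {0..T} \<Longrightarrow> u s \<in> Domain A"
    and contA: "continuous_on {0..T} (\<lambda>s. A \<cdot> u s)" and contM: "continuous_on {0..T} (\<lambda>s. M (u s))"
    and eq: "\<And>s. s \<in> {0..T} \<Longrightarrow> u'' s + A \<cdot> u s + M (u s) = f s"
    using sol unfolding cauchy_solution_def by metis
  define p where "p s = A \<cdot> u s" for s
  have up: "Q (Q (p s)) = u s" if "s \<in> {0..T}" for s
    unfolding p_def using op_apply_mem[OF selfadjoint_opD(2)[OF A(1)] uA[OF that]] by (rule Q(2))
  have w1p: "w1 s = Q (p s)" if "s \<in> {0..T}" for s
    unfolding w1 using Q(4)[of "Q (p s)"] by (simp add: up[OF that])
  have w2g: "w2 s = Q (ft s)" for s unfolding w2 by (rule Q(3))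
  have u''_eq: "u'' s = ft s - p s" if "s \<in> {0..T}" for s
    using eq[OF that] by (simp add: ft p_def algebra_simps)
  have cont_w1: "continuous_on {0..T} w1"
    using bounded_linear.continuous_on[OF Q(1) contA] by (rule continuous_on_eq) (simp add: w1p p_def)
  have cont_w2: "continuous_on {0..T} w2"
    unfolding w2g ft by (intro bounded_linear.continuous_on[OF Q(1)] continuous_intros f contM)

  define \<theta> where "\<theta> i = \<tau>\<^sup>2 * (c1 * norm (A \<cdot> u (t i)) + c3 * norm (ft (t i)))
      + \<tau> * (c1 * J i (t (i - 1)) w1 + c2 * J i (t (i + 1)) w1)
      + c2 * integral {t (i - 1)..t (i + 1)} (\<lambda>s. J i s w1 + J i s w2)" for i
  have \<Theta>_eq: "\<Theta> k = (\<Sum>i=1..k. \<theta> i)" for k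
    unfolding \<Theta> \<theta>_def sum_distrib_left by (simp only: sum.distrib)
  have \<theta>_nn: "0 \<le> \<theta> i" for i
  proof -
    \<comment> \<open>Gronwall's monotonicity asks for every index, also those whose interval leaves
      [0, T]; where the integrand is not integrable, the integral has the default value 0.\<close>
    have "0 \<le> integral {t (i - 1)..t (i + 1)} (\<lambda>s. J i s w1 + J i s w2)"
      by (cases "(\<lambda>s. J i s w1 + J i s w2) integrable_on {t (i - 1)..t (i + 1)}")
        (auto intro!: integral_nonneg simp: J not_integrable_integral)
    then show ?thesis
      unfolding \<theta>_def using c1_nn c2_nn c3_nn \<tau>0 by (intro add_nonneg_nonneg mult_nonneg_nonneg) (auto simp: J)
  qed

  \<comment> \<open>The residual of the exact solution in the scheme, and below, in
    \<open>b\<close>, the same with the error of the nonlinearity added.\<close>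
  define \<delta> where "\<delta> i = S.L (2 *\<^sub>R u (t i) - u (t (i - 1))) + \<tau>\<^sup>2 *\<^sub>R P 1 (ft (t i)) - u (t (i + 1))" for i
  have defect: "norm (S.V k (\<delta> i)) \<le> \<theta> i" if i: "1 \<le> i" "i < n" for i k
  proof -
    obtain i' where i': "i = Suc i'" using i by (cases i) auto
    have tb: "t (i - 1) = t i - \<tau>" "t (i + 1) = t i + \<tau>" unfolding i' by (simp_all add: t0)
    have tT: "t (i - 1) \<in> {0..T}" "t i \<in> {0..T}" "t (i + 1) \<in> {0..T}" using i by (auto intro!: t_in simp del: atLeastAtMost_iff)
    have sub: "{t i - \<tau>..t i + \<tau>} \<subseteq> {0..T}" using tT unfolding tb by auto
    let ?X = "c2 * integral {t (i - 1)..t (i + 1)} (\<lambda>s. J i s w1 + J i s w2)"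
    have X: "norm (S.V k (R ((u (t i + \<tau>) - 2 *\<^sub>R u (t i) + u (t i - \<tau>)) - \<tau>\<^sup>2 *\<^sub>R u'' (t i))))
        \<le> integral {t i - \<tau>..t i + \<tau>} (\<lambda>s. c2 * (J i s w1 + J i s w2))"
    proof (rule S.V_R_second_difference[where u' = u'])
      fix s assume s: "s \<in> {t i - \<tau>..t i + \<tau>}"
      then have sT: "s \<in> {0..T}" using sub by blast
      show "(u has_vector_derivative u' s) (at s within {t i - \<tau>..t i + \<tau>})"
        by (rule has_vector_derivative_within_subset[OF u(1)[OF sT] sub])
      show "(u' has_vector_derivative u'' s) (at s within {t i - \<tau>..t i + \<tau>})"
        by (rule has_vector_derivative_within_subset[OF u(2)[OF sT] sub])
      have "Q (u'' s - u'' (t i)) = (w1 (t i) - w1 s) - (w2 (t i) - w2 s)"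
        by (simp add: u''_eq[OF sT] u''_eq[OF tT(2)] w1p[OF sT] w1p[OF tT(2)] w2g linear_diff[OF S.Q(1)])
      then have "norm (Q (u'' s - u'' (t i))) \<le> J i s w1 + J i s w2"
        unfolding J by (simp only: norm_triangle_ineq4)
      then show "S.c2 * norm (Q (u'' s - u'' (t i))) \<le> c2 * (J i s w1 + J i s w2)"
        unfolding c2_eq by (rule mult_left_mono) (rule c2_nn)
    next
      show "(\<lambda>s. c2 * (J i s w1 + J i s w2)) integrable_on {t i - \<tau>..t i + \<tau>}"
        unfolding J using continuous_on_subset[OF cont_w1 sub] continuous_on_subset[OF cont_w2 sub]
        by (intro integrable_continuous_interval continuous_intros)
    qed
    have "norm (S.V k (S.L (2 *\<^sub>R Q (Q (p (t i))) - Q (Q (p (t (i - 1))))) + \<tau>\<^sup>2 *\<^sub>R P 1 (ft (t i))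
          - Q (Q (p (t (i + 1))))))
        \<le> \<tau>\<^sup>2 * (S.c2 * norm (p (t i)) + (1 / sqrt (\<eta> 1) + S.c2) * norm (ft (t i)))
          + \<tau> * ((real m + S.c2) * norm (Q (p (t i)) - Q (p (t (i - 1))))
          + S.c2 * norm (Q (p (t i)) - Q (p (t (i + 1))))) + ?X"
    proof (rule S.V_defect)
      show "norm (S.V k (R (Q (Q (p (t (i + 1)))) - 2 *\<^sub>R Q (Q (p (t i))) + Q (Q (p (t (i - 1))))
          - \<tau>\<^sup>2 *\<^sub>R (ft (t i) - p (t i))))) \<le> ?X"
        unfolding up[OF tT(1)] up[OF tT(2)] up[OF tT(3)]
        unfolding tb u''_eq[OF tT(2), symmetric] using X by simp
    qed
    also have "\<dots> = \<tau>\<^sup>2 * (c2 * norm (A \<cdot> u (t i)) + c3 * norm (ft (t i)))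
          + \<tau> * ((real m + c2) * J i (t (i - 1)) w1 + c2 * J i (t (i + 1)) w1) + ?X"
      unfolding c2_eq c3_eq J w1p[OF tT(1)] w1p[OF tT(2)] w1p[OF tT(3)] p_def ..
    also have "\<dots> \<le> \<theta> i"
      unfolding \<theta>_def using c12 c1_ge \<tau>0
      by (intro add_mono mult_left_mono mult_right_mono order_refl) (auto simp: J)
    finally show ?thesis unfolding \<delta>_def up[OF tT(1)] up[OF tT(2)] up[OF tT(3)] .
  qed

  obtain y where y: "\<forall>k\<in>{1..n - 1}. v (k + 1) = (\<Sum>j=1..m. \<eta> j *\<^sub>R y j (k + 1)) \<and>
      (\<forall>j\<in>{1..m}. y j (k + 1) \<in> Domain (A' j) \<and>
        \<eta> j *\<^sub>R ((y j (k + 1) - 2 *\<^sub>R v k + v (k - 1)) /\<^sub>R \<tau>\<^sup>2) + A' j \<cdot> y j (k + 1)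
          = (if j = 1 then f (real k * \<tau>) - M (v k) else 0))"
    using scheme unfolding splitting_scheme_def by (elim conjE exE)
  have vy: "v (k + 1) = (\<Sum>j=1..m. \<eta> j *\<^sub>R y j (k + 1))" if "k \<in> {1..n - 1}" for k
    using bspec[OF y that] by (rule conjunct1)
  have yA: "y j (k + 1) \<in> Domain (A' j) \<and>
      \<eta> j *\<^sub>R ((y j (k + 1) - 2 *\<^sub>R v k + v (k - 1)) /\<^sub>R \<tau>\<^sup>2) + A' j \<cdot> y j (k + 1)
        = (if j = 1 then f (real k * \<tau>) - M (v k) else 0)"
    if "k \<in> {1..n - 1}" "j \<in> {1..m}" for k j
    by (rule bspec[OF conjunct2[OF bspec[OF y that(1)]] that(2)])
  have v_rec: "v (k + 1) = S.L (2 *\<^sub>R v k - v (k - 1)) + \<tau>\<^sup>2 *\<^sub>R P 1 (f (t k) - M (v k))"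
    if k: "k \<in> {1..n - 1}" for k
  proof -
    let ?g = "f (t k) - M (v k)" and ?x = "2 *\<^sub>R v k - v (k - 1)"
    \<comment> \<open>Each equation is multiplied by \<tau>^2 / \<eta>_j before the resolvent is
      applied; the weight in the average cancels this \<eta>_j, so the source enters as \<tau>^2 P_1
      without a weight.\<close>
    have "\<eta> j *\<^sub>R y j (k + 1) = \<eta> j *\<^sub>R P j ?x + (if j = 1 then \<tau>\<^sup>2 *\<^sub>R P 1 ?g else 0)"
      if j: "j \<in> {1..m}" for j
    proof -
      let ?y = "y j (k + 1)" and ?r = "if j = 1 then ?g else 0"
      note e = \<eta>(1)[OF j] and linP = S.P(1)[OF j]
      have mem: "(?y, A' j \<cdot> ?y) \<in> A' j"
        using yA[OF k j] A'[OF j] by (intro op_apply_mem selfadjoint_opD(2)) auto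
      have "A' j \<cdot> ?y = ?r - (\<eta> j / \<tau>\<^sup>2) *\<^sub>R (?y - ?x)"
        using yA[OF k j] by (simp add: t algebra_simps divide_inverse)
      then have "(\<tau>\<^sup>2 / \<eta> j) *\<^sub>R (A' j \<cdot> ?y) = (\<tau>\<^sup>2 / \<eta> j) *\<^sub>R ?r - (?y - ?x)"
        using e \<tau>0 by (simp only: scaleR_diff_right scaleR_scaleR) simp
      then have "?y + (\<tau>\<^sup>2 / \<eta> j) *\<^sub>R (A' j \<cdot> ?y) = ?x + (\<tau>\<^sup>2 / \<eta> j) *\<^sub>R ?r" by simp
      with PA[OF j mem] have "?y = P j ?x + (\<tau>\<^sup>2 / \<eta> j) *\<^sub>R P j ?r"
        by (simp only: linear_add[OF linP] linear_scale[OF linP])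
      then have "\<eta> j *\<^sub>R ?y = \<eta> j *\<^sub>R P j ?x + \<tau>\<^sup>2 *\<^sub>R P j ?r"
        using e by (simp add: scaleR_add_right)
      then show ?thesis using linear_0[OF linP] by simp
    qed
    then have "v (k + 1) = (\<Sum>j=1..m. \<eta> j *\<^sub>R P j ?x + (if j = 1 then \<tau>\<^sup>2 *\<^sub>R P 1 ?g else 0))"
      unfolding vy[OF k] by (intro sum.cong refl)
    also have "\<dots> = S.L ?x + \<tau>\<^sup>2 *\<^sub>R P 1 ?g"
      using m1 by (simp add: sum.distrib S.L_def)
    finally show ?thesis .
  qed

  define b where "b i = \<delta> i + \<tau>\<^sup>2 *\<^sub>R P 1 (M (u (t i)) - M (v i))" for i
  have z_rec: "z (Suc (Suc k)) = S.L (2 *\<^sub>R z (Suc k) - z k) + b (Suc k)" if "k < n - 1" for k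
    using v_rec[of "Suc k"] that
    by (simp add: z b_def \<delta>_def ft linear_add[OF S.linear_L] linear_diff[OF S.linear_L] linear_scale[OF S.linear_L]
      linear_diff[OF S.P(1)[OF m1, unfolded One_nat_def]] algebra_simps)
  have b_bound: "norm (S.V (Suc l) (b i)) \<le> \<theta> i + c * \<tau> * norm (z i)" if i: "1 \<le> i" "i < n" for l i
  proof -
    let ?d = "M (u (t i)) - M (v i)"
    have "norm (S.V (Suc l) (\<tau>\<^sup>2 *\<^sub>R P 1 ?d)) = \<tau> * (\<tau> * norm (S.V (Suc l) (P 1 ?d)))"
      using \<tau>0 unfolding S.V_lin(3) by (simp add: power2_eq_square)
    also have "\<dots> \<le> \<tau> * (norm ?d / sqrt \<nu>)" using \<tau>0 by (intro mult_left_mono S.V_resolvent_bound m1) auto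
    also have "\<dots> \<le> \<tau> * (a * norm (z i) / sqrt \<nu>)"
      using M(2)[of "u (t i)" "v i"] \<tau>0 \<nu>0
      by (intro mult_left_mono divide_right_mono) (auto simp: z norm_minus_commute)
    finally have "norm (S.V (Suc l) (\<tau>\<^sup>2 *\<^sub>R P 1 ?d)) \<le> c * \<tau> * norm (z i)"
      by (simp add: c_eq algebra_simps)
    with defect[OF i] show ?thesis unfolding b_def S.V_lin(1) by (rule norm_triangle_mono)
  qed

  define d where "d = norm ((z 1 - z 0) /\<^sub>R \<tau>)"
  have z1: "norm (z 1) \<le> norm (z 0) + \<tau> * d"
    using norm_triangle_ineq[of "z 0" "z 1 - z 0"] \<tau>0 by (simp add: d_def divide_inverse_commute[symmetric])
  have step: "norm (z (Suc k)) \<le> d / sqrt \<nu> + norm (z 0) + \<Theta> k + c * \<tau> * (\<Sum>i=1..k. norm (z i))"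
    if k: "1 \<le> k" "k < n" for k
  proof -
    \<comment> \<open>With k >= 1 the polynomial at the initial increment has index at least 2, as
      \<open>V_bound\<close> requires.\<close>
    obtain k' where k': "k = Suc k'" using k by (cases k) auto
    have "z (Suc k) = S.V (Suc k) (z 1) - S.L (S.V k (z 0)) + (\<Sum>i=1..k. S.V (Suc k - i) (b i))"
      by (rule three_term_recurrence[where N = "n - 1", OF S.linear_L]) (use k z_rec in auto)
    \<comment> \<open>Regrouping the data: the increment tolerates the factor 1 / \<tau> of
      \<open>V_bound\<close>, while z_0 must be met by the \<tau>-free
      \<open>cheb_velocity_le\<close>.\<close>
    also have "\<dots> = S.V (Suc k) (z 1 - z 0) + (S.V (Suc k) (z 0) - S.L (S.V k (z 0)))
        + (\<Sum>i=1..k. S.V (Suc k - i) (b i))"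
      by (simp only: S.V_lin(2)) simp
    finally have zk: "z (Suc k) = S.V (Suc k) (z 1 - z 0) + (S.V (Suc k) (z 0) - S.L (S.V k (z 0)))
        + (\<Sum>i=1..k. S.V (Suc k - i) (b i))" .
    have "S.V (Suc k) (z 1 - z 0) = \<tau> *\<^sub>R S.V (Suc k) ((z 1 - z 0) /\<^sub>R \<tau>)"
      using \<tau>0 by (simp only: S.V_lin(3)) simp
    then have 1: "norm (S.V (Suc k) (z 1 - z 0)) \<le> d / sqrt \<nu>"
      using S.V_bound[of k' "(z 1 - z 0) /\<^sub>R \<tau>"] \<tau>0 unfolding k' d_def by (simp del: cheb.simps)
    have 2: "norm (S.V (Suc k) (z 0) - S.L (S.V k (z 0))) \<le> norm (z 0)" by (rule S.cheb_velocity_le)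
    have 3: "norm (\<Sum>i=1..k. S.V (Suc k - i) (b i)) \<le> (\<Sum>i=1..k. \<theta> i + c * \<tau> * norm (z i))"
    proof (rule sum_norm_le)
      fix i assume i: "i \<in> {1..k}"
      then have "Suc k - i = Suc (k - i)" by auto
      then show "norm (S.V (Suc k - i) (b i)) \<le> \<theta> i + c * \<tau> * norm (z i)"
        using b_bound[of i "k - i"] i k by simp
    qed
    have "norm (z (Suc k)) \<le> d / sqrt \<nu> + norm (z 0) + (\<Sum>i=1..k. \<theta> i + c * \<tau> * norm (z i))"
      unfolding zk by (intro norm_triangle_mono 1 2 3)
    then show ?thesis by (simp add: \<Theta>_eq sum.distrib sum_distrib_left)
  qed

  \<comment> \<open>Gronwall runs on the values from z_2 on, which gives the exponent k - 1. The
    remaining term c \<tau> \<open>norm (z 1)\<close> is bounded through \<open>z1\<close> and turns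
    the coefficients into \<open>\<gamma>0\<close> and \<open>\<gamma>1\<close>.\<close>
  define D where "D k = \<gamma>0 * d + \<gamma>1 * norm (z 0) + \<Theta> (Suc k)" for k
  have d_nn: "0 \<le> d" by (simp add: d_def)
  have \<gamma>_nn: "0 \<le> \<gamma>0" "0 \<le> \<gamma>1" using c_nn \<tau>0 unfolding \<gamma>0 \<gamma>1 by simp_all
  have \<gamma>0_eq: "\<gamma>0 = 1 / sqrt \<nu> + c * \<tau>\<^sup>2" using powr_minus_half[OF \<nu>0] unfolding \<gamma>0 by simp
  have gron: "norm (z (Suc (Suc k))) \<le> (1 + c * \<tau>) ^ k * D k" if "k < n - 1" for k
  proof (rule discrete_gronwall[where N = "n - 1" and e = "\<lambda>k. norm (z (Suc (Suc k)))"])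
    show "D i \<le> D j" if "i \<le> j" for i j
      unfolding D_def \<Theta>_eq using that \<theta>_nn by (intro add_left_mono sum_mono2) auto
    show "0 \<le> D i" for i
      unfolding D_def \<Theta>_eq using \<theta>_nn \<gamma>_nn d_nn by (intro add_nonneg_nonneg mult_nonneg_nonneg sum_nonneg) auto
    fix k assume k: "k < n - 1"
    have "(\<Sum>i=1..Suc k. norm (z i)) = norm (z 1) + (\<Sum>i<k. norm (z (Suc (Suc i))))"
      unfolding One_nat_def sum.atLeast1_atMost_eq sum.lessThan_Suc_shift ..
    then have "norm (z (Suc (Suc k))) \<le> d / sqrt \<nu> + norm (z 0) + \<Theta> (Suc k)
        + c * \<tau> * (norm (z 1) + (\<Sum>i<k. norm (z (Suc (Suc i)))))"
      using step[of "Suc k"] k by simp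
    moreover have "c * \<tau> * norm (z 1) \<le> c * \<tau> * (norm (z 0) + \<tau> * d)"
      using z1 c_nn \<tau>0 by (intro mult_left_mono) auto
    ultimately show "norm (z (Suc (Suc k))) \<le> D k + c * \<tau> * (\<Sum>i<k. norm (z (Suc (Suc i))))"
      unfolding D_def \<gamma>0_eq \<gamma>1 by (simp add: algebra_simps power2_eq_square)
  qed (use that c_nn \<tau>0 in auto)

  show ?thesis
  proof (intro conjI ballI)
    fix j assume "j \<in> {1..m}"
    then show "bounded_linear (\<lambda>x. A' j \<cdot> (A\<inverse> \<cdot> x))" by (rule bl)
  next
    fix k assume k: "k \<in> {1..n - 1}"
    then obtain k' where k': "k = Suc k'" by (cases k) auto
    have Dk: "D k' = \<gamma>0 * norm ((z 1 - z 0) /\<^sub>R \<tau>) + \<gamma>1 * norm (z 0) + \<Theta> k"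
      by (simp add: D_def d_def k')
    have D_nn: "0 \<le> D k'"
      unfolding D_def \<Theta>_eq using \<theta>_nn \<gamma>_nn d_nn by (intro add_nonneg_nonneg mult_nonneg_nonneg sum_nonneg) auto
    have "norm (z (k + 1)) \<le> (1 + c * \<tau>) ^ k' * D k'" using gron[of k'] k by (simp add: k')
    also have "\<dots> \<le> exp (c * \<tau>) ^ k' * D k'"
      using D_nn c_nn \<tau>0 by (intro mult_right_mono power_mono exp_ge_add_one_self) auto
    also have "exp (c * \<tau>) ^ k' = exp (c * t (k - 1))"
      by (simp add: exp_of_nat_mult[symmetric] t k' mult.left_commute)
    finally show "norm (z (k + 1)) \<le> exp (c * t (k - 1)) *
        (\<gamma>0 * norm ((z 1 - z 0) /\<^sub>R \<tau>) + \<gamma>1 * norm (z 0) + \<Theta> k)" unfolding Dk .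
  qed
qed

end
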